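(* Let $V$ and $E$ be real reflexive Banach spaces, let $X$ be a real Banach space, let $f\in V^*$, and let $\Lambda\subset E$ be nonempty, closed and convex with $0_E\in\Lambda$. Let $A\colon V\to V^*$, $J\colon X\to\mathbb{R}$, $h\colon V\to\mathbb{R}$, $\gamma\colon V\to X$ and $b\colon V\times E\to\mathbb{R}$ satisfy the following hypotheses. On $A$: (A1) for all $w,v\in V$, $\limsup_{t\to0^+}\langle A(tw+(1-t)v),w-v\rangle\le\langle A(v),w-v\rangle$; (A2) $\langle A(u)+\gamma^*\xi_u-A(v)-\gamma^*\xi_v,u-v\rangle\ge h(u-v)$ for all $u,v\in V$, $\xi_u\in\partial J(\gamma u)$, $\xi_v\in\partial J(\gamma v)$; (A3) $\lim_{\|v\|_V\to+\infty}\frac{\langle A(v),v\rangle}{\|v\|_V^{\max\{\theta,1\}}}=+\infty$, where $\theta$ is the constant in (J2); (A4) $A$ maps bounded sets to bounded sets. On $J$: (J1) $J$ is locally Lipschitz continuous; (J2) there exist $\theta\ge0$, $\alpha_J\ge0$, $\beta_J>0$ such that $J^0(x;-x)\le\alpha_J+\beta_J\|x\|_X^\theta$ for all $x\in X$; (J3) $\partial J$ maps bounded subsets of $X$ into bounded subsets of $X^*$. On $h$: $h(0_V)=0$; (h1) $\limsup_{t\to0^+}\frac{h(tv)}{t}\ge0$ for all $v\in V$; (h2) whenever $v_n\to v$ weakly in $V$, $h(v)\le\limsup_{n\to\infty}h(v_n)$. On $b$: $b$ is bilinear and bounded, and there is $\alpha_b>0$ with $\inf_{\rho\in E\setminus\{0_E\}}\sup_{v\in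 V\setminus\{0_V\}}\frac{b(v,\rho)}{\|v\|_V\|\rho\|_E}\ge\alpha_b$. On $\gamma$: $\gamma$ is linear and continuous. Then there exists at least one $(u,\lambda)\in V\times\Lambda$ such that $$\langle A(u),v-u\rangle+b(v-u,\lambda)+J^0(\gamma u;\gamma v-\gamma u)\ge\langle f,v-u\rangle\quad\text{for all }v\in V,$$ $$b(u,\rho-\lambda)\le0\quad\text{for all }\rho\in\Lambda.$$
   Context: $\langle\cdot,\cdot\rangle$ is the duality pairing between $V^*$ and $V$, and $\gamma^*\colon X^*\to V^*$ is the adjoint of $\gamma$. For a locally Lipschitz function $J\colon X\to\mathbb{R}$, the generalized (Clarke) directional derivative at $x\in X$ in the direction $z\in X$ is $J^0(x;z)=\limsup_{t\to0^+,\,y\to x}\frac{J(y+tz)-J(y)}{t}$, and the generalized gradient is $\partial J(x)=\{\xi\in X^*\mid J^0(x;z)\ge\langle\xi,z\rangle_{X^*\times X}\text{ for all }z\in X\}$. A bilinear $b$ is bounded if $|b(v,\rho)|\le M\|v\|_V\|\rho\|_E$ for some $M\geq 0$ and all $v\in V$, $\rho\in E$. *)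

theory Defs
  imports "HOL-Analysis.Analysis"
begin

text \<open>The topological dual of a real normed space \<open>'a\<close> is the type \<open>'a \<Rightarrow>\<^sub>L real\<close>, and
  the duality pairing of \<open>\<xi>\<close> with \<open>x\<close> is \<open>blinfun_apply \<xi> x\<close>.\<close>

text \<open>The canonical embedding into the bidual is onto.\<close>

definition reflexive_space :: "'a::real_normed_vector itself \<Rightarrow> bool" where
  "reflexive_space _ \<longleftrightarrow>
     (\<forall>\<phi> :: ('a \<Rightarrow>\<^sub>L real) \<Rightarrow>\<^sub>L real. \<exists>x::'a. \<forall>\<xi> :: 'a \<Rightarrow>\<^sub>L real. blinfun_apply \<phi> \<xi> = blinfun_apply \<xi> x)"

definition weakly_converges_to :: "(nat \<Rightarrow> 'a::real_normed_vector) \<Rightarrow> 'a \<Rightarrow> bool" where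
  "weakly_converges_to s x \<longleftrightarrow> (\<forall>\<xi> :: 'a \<Rightarrow>\<^sub>L real. (\<lambda>n. blinfun_apply \<xi> (s n)) \<longlonglongrightarrow> blinfun_apply \<xi> x)"

definition dual_adjoint ::
    "('a::real_normed_vector \<Rightarrow>\<^sub>L 'b::real_normed_vector) \<Rightarrow> ('b \<Rightarrow>\<^sub>L real) \<Rightarrow> ('a \<Rightarrow>\<^sub>L real)" where
  "dual_adjoint g \<xi> = \<xi> o\<^sub>L g"

definition locally_lipschitz ::
    "('a::metric_space \<Rightarrow> 'b::metric_space) \<Rightarrow> bool" where
  "locally_lipschitz J \<longleftrightarrow> (\<forall>x. \<exists>r>0. \<exists>L. L-lipschitz_on (ball x r) J)"

text \<open>The upper limit is taken in the extended reals, so that it is meaningful for every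
  \<open>J\<close>; it is finite when \<open>J\<close> is locally Lipschitz. The point \<open>y = x\<close> is admitted.\<close>

definition clarke_deriv :: "('a::real_normed_vector \<Rightarrow> real) \<Rightarrow> 'a \<Rightarrow> 'a \<Rightarrow> ereal" where
  "clarke_deriv J x z =
     Limsup (at_right 0 \<times>\<^sub>F nhds x) (\<lambda>(t, y). ereal ((J (y + t *\<^sub>R z) - J y) / t))"

definition clarke_gradient ::
    "('a::real_normed_vector \<Rightarrow> real) \<Rightarrow> 'a \<Rightarrow> ('a \<Rightarrow>\<^sub>L real) set" where
  "clarke_gradient J x = {\<xi>. \<forall>z. clarke_deriv J x z \<ge> ereal (blinfun_apply \<xi> z)}"

text \<open>In the direction 0 the derivative vanishes. Hence a growth bound
  \<open>clarke_deriv J x (- x) \<le> a + c * norm x powr p\<close> with \<open>a, c, p \<ge> 0\<close> holds at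
  \<open>x = 0\<close> whether \<open>0 powr 0\<close> is read as 0 (as in HOL) or as 1.\<close>

lemma clarke_deriv_zero: "clarke_deriv J x 0 = 0"
proof -
  have "at_right (0::real) \<times>\<^sub>F nhds x \<noteq> bot"
    by (simp add: prod_filter_eq_bot)
  then show ?thesis
    by (simp add: clarke_deriv_def case_prod_unfold Limsup_const zero_ereal_def)
qed

end

theory Submission
  imports Defs
begin

text \<open>Write \<open>T u = A u + \<gamma>\<^sup>* \<partial>J (\<gamma> u)\<close>. On the weakly compact convex set
  \<open>K = cball 0 R \<times> (\<Lambda> \<inter> cball 0 R')\<close> the problem asks for \<open>(u, \<lambda>)\<close> with
  \<open>\<langle>T u - f, v - u\<rangle> + b v \<lambda> - b u \<rho> \<ge> 0\<close> for all \<open>(v, \<rho>)\<close>. By A2 this implies the Minty inequality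
  \<open>\<langle>T v - f, v - u\<rangle> - h (u - v) + b v \<lambda> - b u \<rho> \<ge> 0\<close>, whose solution sets are weakly sequentially
  closed by h2 and have the KKM property because the first form is affine in \<open>(v, \<rho>)\<close>. The KKM
  lemma and weak compactness give a common Minty solution, and A1, h1 and the upper semicontinuity
  of the Clarke derivative lead back along segments. Testing with \<open>(0, 0)\<close> bounds \<open>u\<close> by coercivity
  independently of \<open>R\<close> and \<open>R'\<close>, and then the inf-sup condition bounds \<open>\<lambda>\<close> independently of \<open>R'\<close>,
  so for large radii the truncation is inactive.

  The Minty sets are only sequentially closed and \<open>V\<close> need not be separable, so the passage to weak
  compactness uses the Eberlein--Smulian theorem.\<close>

subsection \<open>The Hahn--Banach theorem\<close>

definition sublinear :: "('a::real_vector \<Rightarrow> real) \<Rightarrow> bool" where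
  "sublinear p \<longleftrightarrow> (\<forall>x y. p (x + y) \<le> p x + p y) \<and> (\<forall>c x. c \<ge> 0 \<longrightarrow> p (c *\<^sub>R x) = c * p x)"

text \<open>Applying the inequality to the inverse scalar gives the reverse one, so only one half of
  homogeneity has to be checked for functionals built from infima or upper limits.\<close>

lemma sublinearI:
  assumes "\<And>x y. p (x + y) \<le> p x + p y" and "p 0 = 0"
    and "\<And>c x. c > 0 \<Longrightarrow> p (c *\<^sub>R x) \<le> c * p x"
  shows "sublinear p"
proof -
  have "p (c *\<^sub>R x) = c * p x" if "c \<ge> 0" for c x
  proof (cases "c = 0")
    case False
    then have "p (inverse c *\<^sub>R (c *\<^sub>R x)) \<le> inverse c * p (c *\<^sub>R x)"
      using that by (intro assms(3)) auto
    then have "c * p x \<le> p (c *\<^sub>R x)"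
      using False that by (simp add: field_simps)
    with assms(3)[of c x] False that show ?thesis by simp
  qed (simp add: assms(2))
  then show ?thesis using assms(1) by (simp add: sublinear_def)
qed

lemma sublinear_add: "sublinear p \<Longrightarrow> p (x + y) \<le> p x + p y"
  by (simp add: sublinear_def)

lemma sublinear_scale: "sublinear p \<Longrightarrow> c \<ge> 0 \<Longrightarrow> p (c *\<^sub>R x) = c * p x"
  by (simp add: sublinear_def)

lemma sublinear_0: "sublinear p \<Longrightarrow> p 0 = 0"
  using sublinear_scale[of p 0 0] by simp

lemma sublinear_minus_le: "sublinear p \<Longrightarrow> - p (- x) \<le> p x"
  using sublinear_add[of p x "- x"] sublinear_0[of p] by simp

lemma sublinear_norm: "sublinear norm"
  by (simp add: sublinear_def norm_triangle_ineq)

text \<open>This moves the condition on \<open>K\<close> into the dominating functional: a linear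
  functional below \<open>q\<close> is below \<open>p\<close> and at least \<open>d\<close> on
  \<open>K\<close>. Separation is thereby reduced to the plain dominated form of Hahn-Banach. The
  witness is the infimum of \<open>p (z + s k) - s d\<close> over \<open>s \<ge> 0\<close> and
  \<open>k \<in> K\<close>.\<close>

lemma sublinear_tilt:
  fixes p :: "'a::real_vector \<Rightarrow> real"
  assumes p: "sublinear p" and K: "convex K" "K \<noteq> {}" and d: "\<And>k. k \<in> K \<Longrightarrow> d \<le> p k"
  obtains q where "sublinear q" "\<And>x. q x \<le> p x" "\<And>k. k \<in> K \<Longrightarrow> q (- k) \<le> - d"
proof -
  define F where "F z = (\<lambda>(s, k). p (z + s *\<^sub>R k) - s * d)" for z
  define I where "I = {0::real..} \<times> K"
  define q where "q z = (INF i\<in>I. F z i)" for z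
  obtain k0 where k0: "k0 \<in> K" using K by auto
  have I_ne: "I \<noteq> {}" using K by (auto simp: I_def)
  \<comment> \<open>The bound does not depend on the index, so the infimum defining \<open>q\<close>
    is finite.\<close>
  have lower: "- p (- z) \<le> F z i" if "i \<in> I" for z i
  proof -
    obtain s k where i: "i = (s, k)" "s \<ge> 0" "k \<in> K"
      using \<open>i \<in> I\<close> unfolding I_def by blast
    have "s * d \<le> s * p k" using i d by (simp add: mult_left_mono)
    also have "\<dots> = p ((z + s *\<^sub>R k) + (- z))" using i sublinear_scale[OF p] by simp
    also have "\<dots> \<le> p (z + s *\<^sub>R k) + p (- z)" by (rule sublinear_add[OF p])
    finally show ?thesis by (simp add: i F_def)
  qed
  have bdd: "bdd_below (F z ` I)" for z
    using lower by (auto intro!: bdd_belowI2[where m = "- p (- z)"])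
  have q_le: "q z \<le> F z i" if "i \<in> I" for z i
    unfolding q_def using that bdd by (rule cINF_lower[rotated])
  have q_ge: "c \<le> q z" if "\<And>i. i \<in> I \<Longrightarrow> c \<le> F z i" for c z
    unfolding q_def using I_ne that by (rule cINF_greatest)
  have q_le_p: "q z \<le> p z" for z
    using q_le[of "(0, k0)" z] k0 by (simp add: I_def F_def)
  have F_add: "q (x + y) \<le> F x i + F y j" if i: "i \<in> I" and j: "j \<in> I" for x y i j
  proof -
    obtain s k where i: "i = (s, k)" "s \<ge> 0" "k \<in> K" using i unfolding I_def by blast
    obtain t l where j: "j = (t, l)" "t \<ge> 0" "l \<in> K" using j unfolding I_def by blast
    \<comment> \<open>Convexity of \<open>K\<close> merges two indices into one: up to the factor
      \<open>s + t\<close> the combination is a point of \<open>K\<close>. If the factor is 0, both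
      scalars vanish and any point serves.\<close>
    obtain m where m: "m \<in> K" "s *\<^sub>R k + t *\<^sub>R l = (s + t) *\<^sub>R m"
    proof (cases "s + t = 0")
      case True
      then have "s = 0" "t = 0" using i j by auto
      then show ?thesis using that[of k0] k0 by simp
    next
      case False
      then have st: "s + t > 0" using i j by simp
      have "(s / (s + t)) *\<^sub>R k + (t / (s + t)) *\<^sub>R l \<in> K"
        using i j st by (intro convexD[OF K(1)]) (auto simp: add_divide_distrib[symmetric])
      moreover have "s *\<^sub>R k + t *\<^sub>R l = (s + t) *\<^sub>R ((s / (s + t)) *\<^sub>R k + (t / (s + t)) *\<^sub>R l)"
        using st by (simp add: scaleR_add_right)
      ultimately show ?thesis using that by blast
    qed
    have "q (x + y) \<le> F (x + y) (s + t, m)"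
      using i j m by (intro q_le) (auto simp: I_def)
    also have "x + y + (s + t) *\<^sub>R m = (x + s *\<^sub>R k) + (y + t *\<^sub>R l)"
      using m(2) by (simp add: algebra_simps)
    then have "F (x + y) (s + t, m) = p ((x + s *\<^sub>R k) + (y + t *\<^sub>R l)) - (s + t) * d"
      by (simp only: F_def prod.case)
    also have "\<dots> \<le> F x i + F y j"
      using sublinear_add[OF p, of "x + s *\<^sub>R k" "y + t *\<^sub>R l"] by (simp add: i j F_def algebra_simps)
    finally show ?thesis .
  qed
  have "sublinear q"
  proof (rule sublinearI)
    fix x y
    have "q (x + y) - F x i \<le> q y" if "i \<in> I" for i
      by (rule q_ge) (use F_add[OF that, of _ x y] in \<open>simp add: algebra_simps\<close>)
    then have "q (x + y) - q y \<le> F x i" if "i \<in> I" for i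
      using that by (simp add: algebra_simps)
    then have "q (x + y) - q y \<le> q x" by (rule q_ge)
    then show "q (x + y) \<le> q x + q y" by simp
  next
    show "q 0 = 0"
      using q_le_p[of 0] q_ge[of 0 0] lower[of _ 0] sublinear_0[OF p] by fastforce
  next
    fix c :: real and x
    assume c: "c > 0"
    have "q (c *\<^sub>R x) / c \<le> F x i" if "i \<in> I" for i
    proof -
      obtain s k where i: "i = (s, k)" "s \<ge> 0" "k \<in> K" using \<open>i \<in> I\<close> unfolding I_def by blast
      have "p (c *\<^sub>R x + (c * s) *\<^sub>R k) = c * p (x + s *\<^sub>R k)"
        using c sublinear_scale[OF p, of c "x + s *\<^sub>R k"] by (simp add: scaleR_add_right)
      then have "F (c *\<^sub>R x) (c * s, k) = c * F x i"
        by (simp add: F_def i right_diff_distrib)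
      moreover have "q (c *\<^sub>R x) \<le> F (c *\<^sub>R x) (c * s, k)"
        using i c by (intro q_le) (auto simp: I_def)
      ultimately show ?thesis using c by (simp add: field_simps)
    qed
    then have "q (c *\<^sub>R x) / c \<le> q x" by (rule q_ge)
    then show "q (c *\<^sub>R x) \<le> c * q x" using c by (simp add: field_simps)
  qed
  moreover have "q (- k) \<le> - d" if "k \<in> K" for k
    using q_le[of "(1, k)" "- k"] that sublinear_0[OF p] by (simp add: I_def F_def)
  ultimately show ?thesis using that q_le_p by blast
qed

text \<open>Zorn's lemma applies because the pointwise infimum of a chain is again sublinear, its
  values at \<open>x\<close> being bounded below by \<open>- p (- x)\<close>. The order
  \<open>P\<close> is reversed, so that its maximal elements are the minimal functionals.\<close>

lemma minimal_sublinear_exists: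
  fixes p :: "'a::real_vector \<Rightarrow> real"
  assumes p: "sublinear p"
  obtains m where "sublinear m" "\<And>x. m x \<le> p x" "\<And>q. sublinear q \<Longrightarrow> (\<And>x. q x \<le> m x) \<Longrightarrow> q = m"
proof -
  define A where "A = {q. sublinear q \<and> (\<forall>x. q x \<le> p x)}"
  define P where "P = (\<lambda>f g :: 'a \<Rightarrow> real. \<forall>x. g x \<le> f x)"
  have "\<exists>m\<in>A. \<forall>a\<in>A. P m a \<longrightarrow> a = m"
  proof (rule predicate_Zorn)
    show "partial_order_on A (relation_of P A)"
      by (rule partial_order_on_relation_ofI)
        (auto simp: P_def fun_eq_iff intro: order_trans order_antisym)
  next
    fix C assume C: "C \<in> Chains (relation_of P A)"
    have CA: "C \<subseteq> A" using C by (auto simp: Chains_def relation_of_def)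
    have tot: "P f g \<or> P g f" if "f \<in> C" "g \<in> C" for f g
      using C that by (auto simp: Chains_def relation_of_def)
    show "\<exists>u\<in>A. \<forall>a\<in>C. P a u"
    proof (cases "C = {}")
      case True
      then show ?thesis using p by (auto simp: A_def)
    next
      case False
      define u where "u x = (INF q\<in>C. q x)" for x
      have low: "- p (- x) \<le> q x" if "q \<in> C" for q x
      proof -
        have "sublinear q" "q (- x) \<le> p (- x)" using that CA by (auto simp: A_def)
        then show ?thesis using sublinear_minus_le[of q x] by simp
      qed
      have u_le: "u x \<le> q x" if "q \<in> C" for q x
        unfolding u_def using that low
        by (intro cINF_lower bdd_belowI2[where m = "- p (- x)"]) auto
      have u_ge: "c \<le> u x" if "\<And>q. q \<in> C \<Longrightarrow> c \<le> q x" for c x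
        unfolding u_def using False that by (rule cINF_greatest)
      have sub: "sublinear q" if "q \<in> C" for q using that CA by (auto simp: A_def)
      have "sublinear u"
      proof (rule sublinearI)
        fix x y
        \<comment> \<open>Two members of a chain are comparable, so the smaller one lies below both
          and its subadditivity can be used.\<close>
        have *: "u (x + y) \<le> f x + g y" if fg: "f \<in> C" "g \<in> C" for f g
        proof -
          obtain k where k: "k \<in> C" "k x \<le> f x" "k y \<le> g y"
            using tot[OF fg] fg unfolding P_def by blast
          have "u (x + y) \<le> k (x + y)" by (rule u_le[OF k(1)])
          also have "\<dots> \<le> k x + k y" by (rule sublinear_add[OF sub[OF k(1)]])
          finally show ?thesis using k(2,3) by simp
        qed
        have "u (x + y) - f x \<le> u y" if "f \<in> C" for f
          by (rule u_ge) (use *[OF that] in \<open>simp add: algebra_simps\<close>)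
        then have "u (x + y) - u y \<le> f x" if "f \<in> C" for f
          using that by (simp add: algebra_simps)
        then have "u (x + y) - u y \<le> u x" by (rule u_ge)
        then show "u (x + y) \<le> u x + u y" by simp
      next
        show "u 0 = 0"
          using False sub sublinear_0 u_le u_ge[of 0 0] by (metis all_not_in_conv order.eq_iff)
      next
        fix c :: real and x assume c: "c > 0"
        have "u (c *\<^sub>R x) / c \<le> q x" if "q \<in> C" for q
          using u_le[OF that, of "c *\<^sub>R x"] c sublinear_scale[OF sub[OF that], of c x]
          by (simp add: field_simps)
        then have "u (c *\<^sub>R x) / c \<le> u x" by (rule u_ge)
        then show "u (c *\<^sub>R x) \<le> c * u x" using c by (simp add: field_simps)
      qed
      moreover have "u x \<le> p x" for x
      proof -
        obtain q where "q \<in> C" using False by auto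
        then show ?thesis using u_le[of q x] CA by (force simp: A_def intro: order_trans)
      qed
      ultimately show ?thesis using u_le by (auto simp: A_def P_def)
    qed
  qed
  then obtain m where m: "m \<in> A" "\<And>a. a \<in> A \<Longrightarrow> P m a \<Longrightarrow> a = m" by auto
  show ?thesis
  proof (rule that)
    show "sublinear m" "\<And>x. m x \<le> p x" using m by (auto simp: A_def)
    show "q = m" if "sublinear q" "\<And>x. q x \<le> m x" for q
    proof (rule m(2))
      show "q \<in> A" using that m(1) by (auto simp: A_def intro: order_trans)
      show "P m q" using that by (auto simp: P_def)
    qed
  qed
qed

text \<open>A minimal sublinear functional is odd, since tilting it at a point changes nothing.\<close>

theorem Hahn_Banach_sublinear:
  fixes p :: "'a::real_vector \<Rightarrow> real"
  assumes "sublinear p"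
  obtains l where "linear l" "\<And>x. l x \<le> p x"
proof -
  obtain m where m: "sublinear m" "\<And>x. m x \<le> p x"
    and min: "\<And>q. sublinear q \<Longrightarrow> (\<And>x. q x \<le> m x) \<Longrightarrow> q = m"
    using minimal_sublinear_exists[OF assms] by metis
  have odd: "m (- x) = - m x" for x
  proof -
    obtain q where q: "sublinear q" "\<And>y. q y \<le> m y" "\<And>k. k \<in> {x} \<Longrightarrow> q (- k) \<le> - m x"
      using sublinear_tilt[OF m(1), of "{x}" "m x"] by auto
    then have "m (- x) \<le> - m x" using min by fastforce
    then show ?thesis using sublinear_minus_le[OF m(1), of x] by simp
  qed
  have "linear m"
  proof (rule linearI)
    fix x y
    have "m (- x + - y) \<le> m (- x) + m (- y)" by (rule sublinear_add[OF m(1)])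
    then have "m x + m y \<le> m (x + y)" using odd[of "x + y"] by (simp add: odd)
    then show "m (x + y) = m x + m y" using sublinear_add[OF m(1), of x y] by simp
  next
    fix c x
    show "m (c *\<^sub>R x) = c *\<^sub>R m x"
    proof (cases "c \<ge> 0")
      case False
      then have "m ((- c) *\<^sub>R x) = (- c) * m x" by (intro sublinear_scale[OF m(1)]) simp
      then show ?thesis using odd[of "c *\<^sub>R x"] by simp
    qed (simp add: sublinear_scale[OF m(1)])
  qed
  then show ?thesis using m that by blast
qed

text \<open>The bound by a multiple of the norm gives continuity. A singleton \<open>K\<close>
  yields a functional attaining \<open>p\<close> at a point; a general convex \<open>K\<close>
  yields separation.\<close>

lemma Hahn_Banach_blinfun:
  fixes p :: "'a::real_normed_vector \<Rightarrow> real"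
  assumes p: "sublinear p" and L: "\<And>x. p x \<le> L * norm x"
    and K: "convex K" "K \<noteq> {}" and d: "\<And>k. k \<in> K \<Longrightarrow> d \<le> p k"
  obtains \<xi> :: "'a \<Rightarrow>\<^sub>L real" where "\<And>x. \<xi> x \<le> p x" "\<And>k. k \<in> K \<Longrightarrow> d \<le> \<xi> k"
proof -
  obtain q where q: "sublinear q" "\<And>x. q x \<le> p x" "\<And>k. k \<in> K \<Longrightarrow> q (- k) \<le> - d"
    using sublinear_tilt[OF p K d] by blast
  obtain l where l: "linear l" "\<And>x. l x \<le> q x"
    using Hahn_Banach_sublinear[OF q(1)] by blast
  have lp: "l x \<le> p x" for x using l q order_trans by blast
  have "bounded_linear l"
  proof (rule bounded_linear_intro[where K = L])
    fix x
    have "l x \<le> L * norm x" "l (- x) \<le> L * norm x"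
      using lp[of x] L[of x] lp[of "- x"] L[of "- x"] by simp_all
    then show "norm (l x) \<le> norm x * L" by (simp add: linear_neg[OF l(1)] mult.commute abs_le_iff)
  qed (auto simp: linear_add[OF l(1)] linear_cmul[OF l(1)])
  then have "blinfun_apply (Blinfun l) = l" by (rule bounded_linear_Blinfun_apply)
  moreover have "d \<le> l k" if "k \<in> K" for k
    using l(2)[of "- k"] q(3)[OF that] linear_neg[OF l(1)] by simp
  ultimately show ?thesis using that[of "Blinfun l"] lp by simp
qed

text \<open>After translating \<open>x\<close> to the origin, \<open>K\<close> keeps a positive
  distance \<open>d\<close> from 0, so the norm is at least \<open>d\<close> on it and can serve as
  the dominating functional.\<close>

lemma separate_point_closed_convex:
  fixes K :: "'a::real_normed_vector set"
  assumes "convex K" "closed K" "x \<notin> K"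
  obtains \<xi> :: "'a \<Rightarrow>\<^sub>L real" and d where "d > 0" "\<And>k. k \<in> K \<Longrightarrow> \<xi> x + d \<le> \<xi> k"
proof (cases "K = {}")
  case False
  obtain d where d: "d > 0" "\<And>k. k \<in> K \<Longrightarrow> d \<le> dist x k"
  proof -
    have "open (- K)" "x \<in> - K" using assms by auto
    then obtain e where "e > 0" "ball x e \<subseteq> - K" unfolding open_contains_ball by blast
    then show ?thesis using that[of e] by (auto simp: subset_iff not_less[symmetric])
  qed
  obtain \<xi> :: "'a \<Rightarrow>\<^sub>L real" where "\<And>k. k \<in> (\<lambda>k. k - x) ` K \<Longrightarrow> d \<le> \<xi> k"
  proof (rule Hahn_Banach_blinfun[OF sublinear_norm, of 1 "(\<lambda>k. k - x) ` K" d])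
    show "convex ((\<lambda>k. k - x) ` K)"
      using assms(1) by (rule convex_translation_subtract)
  qed (use d False in \<open>auto simp: dist_norm norm_minus_commute\<close>)
  then show ?thesis using that[OF d(1), of \<xi>] by (force simp: blinfun.diff_right)
qed (use that[of 1 0] in auto)

lemma norming_functional:
  fixes x :: "'a::real_normed_vector"
  obtains \<xi> :: "'a \<Rightarrow>\<^sub>L real" where "norm \<xi> \<le> 1" "\<xi> x = norm x"
proof -
  obtain \<xi> :: "'a \<Rightarrow>\<^sub>L real" where \<xi>: "\<And>y. \<xi> y \<le> norm y" "\<And>k. k \<in> {x} \<Longrightarrow> norm x \<le> \<xi> k"
    by (rule Hahn_Banach_blinfun[OF sublinear_norm, of 1 "{x}" "norm x"]) auto
  have "norm \<xi> \<le> 1"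
  proof (rule norm_blinfun_bound)
    fix y show "norm (\<xi> y) \<le> 1 * norm y"
      using \<xi>(1)[of y] \<xi>(1)[of "- y"] by (simp add: abs_le_iff blinfun.minus_right)
  qed simp
  moreover have "\<xi> x = norm x" using \<xi>(1)[of x] \<xi>(2)[of x] by simp
  ultimately show ?thesis using that by blast
qed

subsection \<open>Weak compactness in reflexive spaces\<close>

text \<open>The topology of pointwise convergence on the dual induces on the image the weak topology
  of the space, so weak compactness becomes compactness in a product of real lines.\<close>

definition weak_embed :: "'a::real_normed_vector \<Rightarrow> ('a \<Rightarrow>\<^sub>L real) \<Rightarrow> real" where
  "weak_embed x = (\<lambda>\<xi>. \<xi> x)"

lemma weak_embed_apply [simp]: "weak_embed x \<xi> = \<xi> x"
  by (simp add: weak_embed_def)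

lemma inj_weak_embed: "inj weak_embed"
proof (rule injI)
  fix x y :: 'a assume eq: "weak_embed x = weak_embed y"
  obtain \<xi> :: "'a \<Rightarrow>\<^sub>L real" where "\<xi> (x - y) = norm (x - y)"
    using norming_functional[of "x - y"] by blast
  moreover have "\<xi> x = \<xi> y" using fun_cong[OF eq, of \<xi>] by simp
  ultimately show "x = y" by (simp add: blinfun.diff_right)
qed

section \<open>Weak compactness of closed balls by Tychonoff and reflexivity\<close>

lemma compact_box:
  fixes r :: "'i \<Rightarrow> real"
  shows "compact {\<phi>. \<forall>i. \<bar>\<phi> i\<bar> \<le> r i}"
proof -
  have "compactin (product_topology (\<lambda>i. euclidean) UNIV) (PiE UNIV (\<lambda>i. {- r i..r i}))"
    by (subst compactin_PiE) (auto simp: compactin_euclidean_iff)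
  then have "compact (PiE UNIV (\<lambda>i. {- r i..r i}))"
    by (simp add: euclidean_product_topology compactin_euclidean_iff)
  moreover have "PiE UNIV (\<lambda>i. {- r i..r i}) = {\<phi>. \<forall>i. \<bar>\<phi> i\<bar> \<le> r i}"
    by (auto simp: PiE_def Pi_def abs_le_iff minus_le_iff)
  ultimately show ?thesis by simp
qed

text \<open>Reflexivity represents a bounded linear functional on the dual by a point
  \<open>x\<close>, and a functional norming \<open>x\<close> shows that \<open>x\<close> lies in
  the ball. The right-hand side is a compact box cut by closed linear conditions.\<close>

lemma weak_embed_cball:
  fixes R :: real
  assumes refl: "reflexive_space TYPE('a::real_normed_vector)" and "R \<ge> 0"
  shows "weak_embed ` cball (0::'a) R = {\<phi>. \<forall>\<xi>. \<bar>\<phi> \<xi>\<bar> \<le> R * norm \<xi>} \<inter>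
    {\<phi>. (\<forall>\<xi> \<eta>. \<phi> (\<xi> + \<eta>) = \<phi> \<xi> + \<phi> \<eta>) \<and> (\<forall>c \<xi>. \<phi> (c *\<^sub>R \<xi>) = c * \<phi> \<xi>)}" (is "_ = ?B \<inter> ?L")
proof (intro equalityI subsetI)
  fix \<phi> :: "('a \<Rightarrow>\<^sub>L real) \<Rightarrow> real" assume "\<phi> \<in> weak_embed ` cball 0 R"
  then obtain x where x: "norm x \<le> R" "\<phi> = weak_embed x" by auto
  have "\<bar>\<xi> x\<bar> \<le> R * norm \<xi>" for \<xi> :: "'a \<Rightarrow>\<^sub>L real"
    using norm_blinfun[of \<xi> x] mult_left_mono[OF x(1), of "norm \<xi>"] by (simp add: mult.commute)
  then show "\<phi> \<in> ?B \<inter> ?L" by (simp add: x blinfun.add_left blinfun.scaleR_left)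
next
  fix \<phi> :: "('a \<Rightarrow>\<^sub>L real) \<Rightarrow> real" assume \<phi>: "\<phi> \<in> ?B \<inter> ?L"
  then have "bounded_linear \<phi>"
    by (intro bounded_linear_intro[where K = R]) (auto simp: mult.commute)
  then have \<Phi>: "blinfun_apply (Blinfun \<phi>) = \<phi>" by (rule bounded_linear_Blinfun_apply)
  obtain x where x: "\<And>\<xi>. \<phi> \<xi> = \<xi> x"
    using refl \<Phi> unfolding reflexive_space_def by metis
  obtain \<xi> :: "'a \<Rightarrow>\<^sub>L real" where \<xi>: "norm \<xi> \<le> 1" "\<xi> x = norm x"
    using norming_functional by blast
  have "norm x \<le> R * norm \<xi>" using \<phi> x[of \<xi>] \<xi> by (auto dest: spec[of _ \<xi>])
  also have "\<dots> \<le> R" using \<xi>(1) assms(2) by (simp add: mult_left_le)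
  finally show "\<phi> \<in> weak_embed ` cball 0 R"
    using x by (intro image_eqI[of _ _ x]) auto
qed

lemma compact_weak_embed_cball:
  fixes R :: real
  assumes refl: "reflexive_space TYPE('a::real_normed_vector)"
  shows "compact (weak_embed ` cball (0::'a) R)" "closed (weak_embed ` cball (0::'a) R)"
proof -
  let ?B = "{\<phi> :: ('a \<Rightarrow>\<^sub>L real) \<Rightarrow> real. \<forall>\<xi>. \<bar>\<phi> \<xi>\<bar> \<le> R * norm \<xi>}"
  let ?L = "{\<phi> :: ('a \<Rightarrow>\<^sub>L real) \<Rightarrow> real.
    (\<forall>\<xi> \<eta>. \<phi> (\<xi> + \<eta>) = \<phi> \<xi> + \<phi> \<eta>) \<and> (\<forall>c \<xi>. \<phi> (c *\<^sub>R \<xi>) = c * \<phi> \<xi>)}"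
  have L: "closed ?L"
    by (intro closed_Collect_conj closed_Collect_all closed_Collect_eq continuous_intros
        continuous_on_product_coordinates)
  have B: "closed ?B"
    by (intro closed_Collect_all closed_Collect_le continuous_intros continuous_on_product_coordinates)
  have "compact (?B \<inter> ?L) \<and> closed (?B \<inter> ?L)"
    using L B compact_box by (intro conjI compact_Int_closed closed_Int)
  then have "compact (weak_embed ` cball (0::'a) R) \<and> closed (weak_embed ` cball (0::'a) R)"
  proof (cases "R \<ge> 0")
    case True
    with \<open>compact (?B \<inter> ?L) \<and> _\<close> show ?thesis by (simp only: weak_embed_cball[OF refl])
  qed simp
  then show "compact (weak_embed ` cball (0::'a) R)" "closed (weak_embed ` cball (0::'a) R)"
    by auto
qed

text \<open>Stated for filters so that it applies to a sequence restricted to an infinite set of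
  indices without extracting subnets.\<close>

lemma weak_cluster_point:
  fixes s :: "'b \<Rightarrow> 'a::real_normed_vector"
  assumes refl: "reflexive_space TYPE('a)" and "F \<noteq> bot"
    and bdd: "eventually (\<lambda>n. norm (s n) \<le> R) F"
  obtains y where "\<And>\<xi> :: 'a \<Rightarrow>\<^sub>L real. \<And>e. e > 0 \<Longrightarrow> frequently (\<lambda>n. \<bar>\<xi> (s n) - \<xi> y\<bar> < e) F"
proof -
  let ?G = "filtermap (\<lambda>n. weak_embed (s n)) F"
  have "?G \<noteq> bot" using \<open>F \<noteq> bot\<close> by (simp add: filtermap_bot_iff)
  moreover have "eventually (\<lambda>\<phi>. \<phi> \<in> weak_embed ` cball 0 R) ?G"
    unfolding eventually_filtermap using bdd by eventually_elim auto
  ultimately obtain y where y: "inf (nhds (weak_embed y)) ?G \<noteq> bot"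
    using compact_weak_embed_cball(1)[OF refl, of R] unfolding compact_filter by blast
  have "frequently (\<lambda>n. \<bar>\<xi> (s n) - \<xi> y\<bar> < e) F" if "e > 0" for \<xi> :: "'a \<Rightarrow>\<^sub>L real" and e
  proof (rule ccontr)
    assume "\<not> frequently (\<lambda>n. \<bar>\<xi> (s n) - \<xi> y\<bar> < e) F"
    then have "eventually (\<lambda>\<phi>. \<not> \<bar>\<phi> \<xi> - \<xi> y\<bar> < e) ?G"
      by (simp add: eventually_filtermap frequently_def)
    moreover have "open {\<phi>. \<bar>\<phi> \<xi> - \<xi> y\<bar> < e}"
      by (intro open_Collect_less continuous_intros continuous_on_product_coordinates)
    then have "eventually (\<lambda>\<phi>. \<bar>\<phi> \<xi> - \<xi> y\<bar> < e) (nhds (weak_embed y))"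
      using that by (auto simp: eventually_nhds)
    ultimately have "eventually (\<lambda>_. False) (inf (nhds (weak_embed y)) ?G)"
      unfolding eventually_inf by blast
    with y show False by (simp add: eventually_False)
  qed
  with that show ?thesis by blast
qed

section \<open>From weak closure to weakly convergent sequences\<close>

lemma span_range_explicit:
  fixes d :: "nat \<Rightarrow> 'a::real_vector"
  assumes "w \<in> span (range d)"
  shows "\<exists>m c. w = (\<Sum>i<m. c i *\<^sub>R d i)"
  using assms
proof (induction rule: span_induct_alt)
  case base
  show ?case by (intro exI[of _ 0]) simp
next
  case (step a x y)
  then obtain j m c where j: "x = d j" and y: "y = (\<Sum>i<m. c i *\<^sub>R d i)" by blast
  define M where "M = max m (Suc j)"
  have "y = (\<Sum>i<M. (if i < m then c i else 0) *\<^sub>R d i)"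
    unfolding y M_def by (intro sum.mono_neutral_cong_left) auto
  moreover have "a *\<^sub>R x = (\<Sum>i<M. (if i = j then a else 0) *\<^sub>R d i)"
    by (subst sum.remove[of _ j]) (auto simp: M_def j intro!: sum.neutral)
  ultimately have "a *\<^sub>R x + y = (\<Sum>i<M. ((if i = j then a else 0) + (if i < m then c i else 0)) *\<^sub>R d i)"
    by (simp add: scaleR_add_left sum.distrib)
  then show ?case by (intro exI[of _ M] exI)
qed

text \<open>Lists of rationals are countable, which lets the sequence construction below treat all
  combinations one after another.\<close>

lemma rational_combination_dense:
  fixes d :: "nat \<Rightarrow> 'a::real_normed_vector"
  assumes "w \<in> span (range d)" "e > 0"
  shows "\<exists>q :: rat list. norm (w - (\<Sum>i<length q. of_rat (q ! i) *\<^sub>R d i)) < e"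
proof -
  obtain m c where w: "w = (\<Sum>i<m. c i *\<^sub>R d i)" using span_range_explicit[OF assms(1)] by blast
  have "\<exists>q :: rat. norm (c i *\<^sub>R d i - of_rat q *\<^sub>R d i) \<le> e / (m + 1)" for i
  proof -
    \<comment> \<open>Each of the \<open>m\<close> terms may cost \<open>e / (m + 1)\<close>, so the
      total stays strictly below \<open>e\<close>; the 1 added to the norm avoids division by
      zero.\<close>
    define r where "r = e / (m + 1) / (norm (d i) + 1)"
    have r: "r > 0" using assms(2) by (simp add: r_def add_pos_nonneg add_nonneg_pos)
    obtain q where q: "c i < of_rat q" "of_rat q < c i + r" using of_rat_dense[of "c i" "c i + r"] r by auto
    have "norm (c i *\<^sub>R d i - of_rat q *\<^sub>R d i) = \<bar>c i - of_rat q\<bar> * norm (d i)"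
      by (simp add: scaleR_left_diff_distrib[symmetric])
    also have "\<dots> \<le> r * (norm (d i) + 1)" using q by (intro mult_mono) auto
    also have "\<dots> = e / (m + 1)" using norm_ge_zero[of "d i"] by (simp add: r_def add_nonneg_eq_0_iff)
    finally show ?thesis by blast
  qed
  then obtain q :: "nat \<Rightarrow> rat" where q: "\<And>i. norm (c i *\<^sub>R d i - of_rat (q i) *\<^sub>R d i) \<le> e / (m + 1)" by metis
  have "norm (w - (\<Sum>i<m. of_rat (q i) *\<^sub>R d i)) \<le> (\<Sum>i<m. e / (m + 1))"
    unfolding w sum_subtractf[symmetric] by (rule sum_norm_le) (rule q)
  also have "\<dots> < e" using assms(2) by (simp add: field_simps)
  finally show ?thesis by (intro exI[of _ "map q [0..<m]"]) simp
qed

text \<open>Whitley's argument for the Eberlein--Smulian theorem: each new term is nearly annihilated by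
  functionals norming the rational combinations of the earlier ones, so that a weak cluster point
  of the differences, which lies in their closed span, is annihilated by a norming family.\<close>

lemma weak_closure_sequence:
  fixes C :: "'a::real_normed_vector set"
  assumes refl: "reflexive_space TYPE('a)" and "bounded C"
    and x: "\<And>F :: ('a \<Rightarrow>\<^sub>L real) set. \<And>e. finite F \<Longrightarrow> e > 0 \<Longrightarrow> \<exists>a\<in>C. \<forall>\<xi>\<in>F. \<bar>blinfun_apply \<xi> a - blinfun_apply \<xi> x\<bar> < e"
  obtains s where "\<And>n::nat. s n \<in> C" "weakly_converges_to s x"
proof -
  \<comment> \<open>Since \<open>from_nat\<close> is onto, \<open>comb k\<close> runs through all
    rational combinations as \<open>k\<close> varies.\<close>
  define lst where "lst k = (from_nat k :: rat list)" for k
  define comb where "comb k a = (\<Sum>i<length (lst k). of_rat (lst k ! i) *\<^sub>R a i)" for k and a :: "nat \<Rightarrow> 'a"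
  obtain \<nu> :: "'a \<Rightarrow> ('a \<Rightarrow>\<^sub>L real)" where \<nu>: "\<And>y. norm (\<nu> y) \<le> 1" "\<And>y. \<nu> y y = norm y"
    using norming_functional by metis
  \<comment> \<open>At stage \<open>n\<close> only finitely many functionals are constrained, and
    the length condition makes them depend on terms before \<open>n\<close> alone. So the recursion
    is well founded, and weak closeness of \<open>x\<close> to \<open>C\<close> supplies the next
    term.\<close>
  have "\<exists>s. \<forall>n. s n \<in> C \<and> (\<forall>k<n. length (lst k) \<le> n \<longrightarrow>
      \<bar>\<nu> (comb k (\<lambda>i. s i - x)) (s n - x)\<bar> < inverse (real (Suc n)))"
  proof (rule dependent_wellorder_choice)
    fix r and f g :: "nat \<Rightarrow> 'a" and n :: nat
    assume fg: "\<And>i. i < n \<Longrightarrow> f i = g i"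
    have "comb k (\<lambda>i. f i - x) = comb k (\<lambda>i. g i - x)" if "length (lst k) \<le> n" for k
      unfolding comb_def using that fg by (intro sum.cong) auto
    then show "(r \<in> C \<and> (\<forall>k<n. length (lst k) \<le> n \<longrightarrow> \<bar>\<nu> (comb k (\<lambda>i. f i - x)) (r - x)\<bar> < inverse (real (Suc n)))) =
      (r \<in> C \<and> (\<forall>k<n. length (lst k) \<le> n \<longrightarrow> \<bar>\<nu> (comb k (\<lambda>i. g i - x)) (r - x)\<bar> < inverse (real (Suc n))))"
      by auto
  next
    fix n and f :: "nat \<Rightarrow> 'a"
    show "\<exists>r. r \<in> C \<and> (\<forall>k<n. length (lst k) \<le> n \<longrightarrow> \<bar>\<nu> (comb k (\<lambda>i. f i - x)) (r - x)\<bar> < inverse (real (Suc n)))"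
      using x[of "(\<lambda>k. \<nu> (comb k (\<lambda>i. f i - x))) ` {..<n}" "inverse (real (Suc n))"]
      by (force simp: blinfun.diff_right)
  qed
  then obtain s where sC: "\<And>n. s n \<in> C"
    and s: "\<And>n k. k < n \<Longrightarrow> length (lst k) \<le> n \<Longrightarrow> \<bar>\<nu> (comb k (\<lambda>i. s i - x)) (s n - x)\<bar> < inverse (real (Suc n))"
    by blast
  define d where "d n = s n - x" for n
  obtain R where R: "\<And>c. c \<in> C \<Longrightarrow> norm c \<le> R" using \<open>bounded C\<close> bounded_iff by blast
  have dR: "norm (d n) \<le> R + norm x" for n
    using R[OF sC[of n]] norm_triangle_ineq4[of "s n" x] by (simp add: d_def)
  have lim0: "(\<lambda>n. \<nu> (comb k d) (d n)) \<longlonglongrightarrow> 0" for k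
  proof (rule tendsto_0_le[where K = 1])
    show "(\<lambda>n. inverse (real (Suc n))) \<longlonglongrightarrow> 0" by (rule LIMSEQ_inverse_real_of_nat)
    show "eventually (\<lambda>n. norm (\<nu> (comb k d) (d n)) \<le> norm (inverse (real (Suc n))) * 1) sequentially"
      using eventually_ge_at_top[of "Suc k + length (lst k)"]
    proof eventually_elim
      case (elim n)
      then show ?case using s[of k n] by (simp add: d_def[abs_def])
    qed
  qed
  have "(\<lambda>n. \<xi> (d n)) \<longlonglongrightarrow> 0" for \<xi> :: "'a \<Rightarrow>\<^sub>L real"
  proof (rule ccontr)
    assume "\<not> (\<lambda>n. \<xi> (d n)) \<longlonglongrightarrow> 0"
    then obtain e where e: "e > 0" "\<not> eventually (\<lambda>n. \<bar>\<xi> (d n)\<bar> < e) sequentially"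
      by (auto simp: tendsto_iff)
    \<comment> \<open>If convergence fails for \<open>\<xi>\<close>, infinitely many terms keep
      \<open>\<bar>\<xi> (d n)\<bar>\<close> at least \<open>e\<close>. Restricting to these indices
      ensures that the cluster point \<open>y\<close> is not 0.\<close>
    define F where "F = inf sequentially (principal {n. \<bar>\<xi> (d n)\<bar> \<ge> e})"
    have "F \<noteq> bot"
      using e(2) by (auto simp: F_def trivial_limit_def eventually_inf_principal not_le)
    then obtain y where y: "\<And>\<eta> :: 'a \<Rightarrow>\<^sub>L real. \<And>r. r > 0 \<Longrightarrow> frequently (\<lambda>n. \<bar>\<eta> (d n) - \<eta> y\<bar> < r) F"
      using weak_cluster_point[OF refl, of F d "R + norm x"] dR by (auto intro: always_eventually)
    have y0: "\<nu> (comb k d) y = 0" for k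
    proof (rule ccontr)
      let ?a = "\<nu> (comb k d) y"
      assume "?a \<noteq> 0"
      then have "frequently (\<lambda>n. \<bar>\<nu> (comb k d) (d n) - ?a\<bar> < \<bar>?a\<bar> / 2) F" by (intro y) simp
      moreover have "eventually (\<lambda>n. \<bar>\<nu> (comb k d) (d n)\<bar> < \<bar>?a\<bar> / 2) sequentially"
        using tendstoD[OF lim0, of "\<bar>?a\<bar> / 2" k] \<open>?a \<noteq> 0\<close> by simp
      then have "eventually (\<lambda>n. \<bar>\<nu> (comb k d) (d n)\<bar> < \<bar>?a\<bar> / 2) F"
        by (simp add: F_def eventually_inf_principal eventually_mono)
      ultimately have "frequently (\<lambda>n. \<bar>\<nu> (comb k d) (d n) - ?a\<bar> < \<bar>?a\<bar> / 2 \<and>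
          \<bar>\<nu> (comb k d) (d n)\<bar> < \<bar>?a\<bar> / 2) F" by (rule frequently_eventually_frequently)
      then obtain n where "\<bar>\<nu> (comb k d) (d n) - ?a\<bar> < \<bar>?a\<bar> / 2" "\<bar>\<nu> (comb k d) (d n)\<bar> < \<bar>?a\<bar> / 2"
        using frequently_ex by blast
      then show False by linarith
    qed
    have "y \<noteq> 0"
    proof
      assume "y = 0"
      then have "frequently (\<lambda>n. \<bar>\<xi> (d n)\<bar> < e) F" using y[of e \<xi>] e(1) by simp
      moreover have "eventually (\<lambda>n. \<not> \<bar>\<xi> (d n)\<bar> < e) F"
        by (auto simp: F_def eventually_inf_principal)
      ultimately show False by (simp add: frequently_def)
    qed
    \<comment> \<open>A closed subspace is weakly closed: a functional separating \<open>y\<close>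
      from it would keep all \<open>d n\<close> weakly away from \<open>y\<close>.\<close>
    have "y \<in> closure (span (range d))"
    proof (rule ccontr)
      assume "y \<notin> closure (span (range d))"
      then obtain \<eta> :: "'a \<Rightarrow>\<^sub>L real" and r
        where r: "r > 0" "\<And>k. k \<in> closure (span (range d)) \<Longrightarrow> \<eta> y + r \<le> \<eta> k"
        using separate_point_closed_convex[OF convex_closure[OF subspace_imp_convex[OF subspace_span]]
            closed_closure, of y "range d"] by blast
      obtain n where "\<bar>\<eta> (d n) - \<eta> y\<bar> < r" using frequently_ex[OF y[OF r(1), of \<eta>]] by auto
      moreover have "d n \<in> closure (span (range d))"
        using closure_subset[of "span (range d)"] span_base[of "d n" "range d"] by auto
      ultimately show False using r(2)[of "d n"] by simp
    qed
    then obtain w where w: "w \<in> span (range d)" "dist w y < norm y / 4"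
      using \<open>y \<noteq> 0\<close> closure_approachable[of y] by (metis divide_pos_pos zero_less_norm_iff zero_less_numeral)
    then obtain q where "norm (w - (\<Sum>i<length q. of_rat (q ! i) *\<^sub>R d i)) < norm y / 4"
      using rational_combination_dense[OF w(1), of "norm y / 4"] \<open>y \<noteq> 0\<close> by auto
    then have k: "norm (w - comb (to_nat q) d) < norm y / 4"
      by (simp add: comb_def lst_def)
    let ?c = "comb (to_nat q) d"
    have "norm (y - ?c) \<le> norm (w - ?c) + dist w y"
      using norm_triangle_ineq[of "w - ?c" "y - w"] by (simp add: dist_norm norm_minus_commute)
    then have yc: "norm (y - ?c) < norm y / 2" using k w(2) by simp
    \<comment> \<open>The functional norming the combination annihilates \<open>y\<close>, so the
      combination is no longer than its distance to \<open>y\<close>, which is less than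
      \<open>norm y / 2\<close>. Then \<open>y\<close> would be shorter than itself.\<close>
    have "norm ?c = \<nu> ?c (?c - y)" using \<nu>(2)[of ?c] y0[of "to_nat q"] by (simp add: blinfun.diff_right)
    also have "\<dots> \<le> norm (\<nu> ?c) * norm (?c - y)"
      using norm_blinfun[of "\<nu> ?c" "?c - y"] by simp
    also have "\<dots> \<le> norm (?c - y)" using \<nu>(1)[of ?c] by (simp add: mult_left_le_one_le)
    finally have "norm ?c < norm y / 2" using yc by (simp add: norm_minus_commute)
    with yc show False using norm_triangle_ineq[of "y - ?c" ?c] by simp
  qed
  then have "weakly_converges_to s x"
    unfolding weakly_converges_to_def d_def using LIM_zero_cancel by (fastforce simp: blinfun.diff_right)
  with that sC show ?thesis by blast
qed

section \<open>Weak sequential closedness and weak compactness\<close>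

definition weakly_seq_closed :: "'a::real_normed_vector set \<Rightarrow> bool" where
  "weakly_seq_closed C \<longleftrightarrow> (\<forall>s x. (\<forall>n. s n \<in> C) \<longrightarrow> weakly_converges_to s x \<longrightarrow> x \<in> C)"

text \<open>A closure point of the image is represented by some \<open>x\<close>, because the
  surrounding ball has a closed image. The Eberlein-Smulian sequence then reaches \<open>x\<close>
  from within \<open>C\<close>, and sequential closedness suffices.\<close>

lemma compact_weak_embed:
  fixes C :: "'a::real_normed_vector set"
  assumes refl: "reflexive_space TYPE('a)" and "bounded C" and C: "weakly_seq_closed C"
  shows "compact (weak_embed ` C)" "closed (weak_embed ` C)"
proof -
  obtain R where R: "C \<subseteq> cball 0 R" using \<open>bounded C\<close> by (auto simp: bounded_iff subset_iff)
  note Q = compact_weak_embed_cball[OF refl, of R]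
  have "closure (weak_embed ` C) \<subseteq> weak_embed ` C"
  proof
    fix \<phi> assume \<phi>: "\<phi> \<in> closure (weak_embed ` C)"
    have "closure (weak_embed ` C) \<subseteq> weak_embed ` cball 0 R"
      using R Q(2) by (intro closure_minimal image_mono)
    then obtain x where x: "\<phi> = weak_embed x" using \<phi> by auto
    have near: "\<exists>a\<in>C. \<forall>\<xi>\<in>F. \<bar>\<xi> a - \<xi> x\<bar> < e" if "finite F" "e > 0" for F :: "('a \<Rightarrow>\<^sub>L real) set" and e
    proof -
      \<comment> \<open>Finitely many evaluations define an open set of the product topology, so a
        closure point is approximated on every finite set of functionals.\<close>
      let ?U = "{\<psi> :: ('a \<Rightarrow>\<^sub>L real) \<Rightarrow> real. \<forall>\<xi>\<in>F. \<bar>\<psi> \<xi> - blinfun_apply \<xi> x\<bar> < e}"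
      have "open (\<Inter>\<xi>\<in>F. {\<psi> :: ('a \<Rightarrow>\<^sub>L real) \<Rightarrow> real. \<bar>\<psi> \<xi> - blinfun_apply \<xi> x\<bar> < e})"
        using \<open>finite F\<close> by (intro open_INT ballI open_Collect_less continuous_intros continuous_on_product_coordinates)
      also have "(\<Inter>\<xi>\<in>F. {\<psi> :: ('a \<Rightarrow>\<^sub>L real) \<Rightarrow> real. \<bar>\<psi> \<xi> - blinfun_apply \<xi> x\<bar> < e}) = ?U" by auto
      finally have "open ?U" .
      moreover have "weak_embed x \<in> ?U" using \<open>e > 0\<close> by simp
      then have "?U \<inter> closure (weak_embed ` C) \<noteq> {}" using \<phi> x by blast
      ultimately have "?U \<inter> weak_embed ` C \<noteq> {}"
        using open_Int_closure_eq_empty[of ?U "weak_embed ` C"] by blast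
      then obtain a where "a \<in> C" "weak_embed a \<in> ?U" by blast
      then show ?thesis by (intro bexI[of _ a]) simp_all
    qed
    obtain s where "\<And>n::nat. s n \<in> C" "weakly_converges_to s x"
      using weak_closure_sequence[OF refl \<open>bounded C\<close> near] by (metis (no_types, lifting))
    then have "x \<in> C" using C unfolding weakly_seq_closed_def by blast
    then show "\<phi> \<in> weak_embed ` C" using x by blast
  qed
  then show *: "closed (weak_embed ` C)"
    by (simp add: closure_subset_eq)
  have "weak_embed ` cball 0 R \<inter> weak_embed ` C = weak_embed ` C" using R by auto
  then show "compact (weak_embed ` C)"
    using compact_Int_closed[OF Q(1) *] by simp
qed

text \<open>The finite intersection property is applied to the compact images, and injectivity of
  \<open>weak_embed\<close> reads the common point back in the space.\<close>

lemma weakly_seq_closed_fip: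
  fixes K :: "'a::real_normed_vector set"
  assumes refl: "reflexive_space TYPE('a)" and "bounded K" "weakly_seq_closed K"
    and G: "\<And>i. i \<in> I \<Longrightarrow> weakly_seq_closed (K \<inter> G i)"
    and fip: "\<And>I'. finite I' \<Longrightarrow> I' \<subseteq> I \<Longrightarrow> K \<inter> (\<Inter>i\<in>I'. G i) \<noteq> {}"
  shows "K \<inter> (\<Inter>i\<in>I. G i) \<noteq> {}"
proof -
  have "weak_embed ` K \<inter> (\<Inter>i\<in>I. weak_embed ` (K \<inter> G i)) \<noteq> {}"
  proof (rule compact_imp_fip_image)
    show "compact (weak_embed ` K)"
      by (rule compact_weak_embed(1)[OF refl \<open>bounded K\<close> \<open>weakly_seq_closed K\<close>])
    fix i assume "i \<in> I"
    have "bounded (K \<inter> G i)" using \<open>bounded K\<close> by (rule bounded_subset) auto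
    then show "closed (weak_embed ` (K \<inter> G i))"
      by (rule compact_weak_embed(2)[OF refl _ G[OF \<open>i \<in> I\<close>]])
  next
    fix I' assume "finite I'" "I' \<subseteq> I"
    then obtain x where "x \<in> K" "\<And>i. i \<in> I' \<Longrightarrow> x \<in> G i" using fip[of I'] by blast
    then show "weak_embed ` K \<inter> (\<Inter>i\<in>I'. weak_embed ` (K \<inter> G i)) \<noteq> {}" by blast
  qed
  then obtain x where x: "x \<in> K" "\<And>i. i \<in> I \<Longrightarrow> weak_embed x \<in> weak_embed ` (K \<inter> G i)" by blast
  then have "x \<in> G i" if "i \<in> I" for i
    using x(2)[OF that] unfolding inj_image_mem_iff[OF inj_weak_embed] by simp
  with x(1) have "x \<in> K \<inter> (\<Inter>i\<in>I. G i)" by simp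
  then show ?thesis by blast
qed

text \<open>Mazur's theorem: a separating functional leaves a gap \<open>d\<close> that a weakly
  convergent sequence cannot cross.\<close>

lemma weakly_seq_closed_convex:
  fixes K :: "'a::real_normed_vector set"
  assumes "convex K" "closed K"
  shows "weakly_seq_closed K"
  unfolding weakly_seq_closed_def
proof (intro allI impI, rule ccontr)
  fix s x assume s: "\<forall>n. s n \<in> K" "weakly_converges_to s x" "x \<notin> K"
  obtain \<xi> :: "'a \<Rightarrow>\<^sub>L real" and d where d: "d > 0" "\<And>k. k \<in> K \<Longrightarrow> \<xi> x + d \<le> \<xi> k"
    using separate_point_closed_convex[OF assms s(3)] by metis
  have "\<xi> x + d \<le> \<xi> x"
  proof (rule LIMSEQ_le_const)
    show "(\<lambda>n. \<xi> (s n)) \<longlonglongrightarrow> \<xi> x" using s(2) by (simp add: weakly_converges_to_def)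
  qed (use s(1) d(2) in blast)
  with d(1) show False by simp
qed

text \<open>Every functional on the product is the sum of its restrictions to the factors, extended
  by the projections (\<open>pa\<close>, \<open>pb\<close>). A bidual element is therefore given by
  one on each factor, and these are represented by points.\<close>

lemma reflexive_space_prod:
  assumes "reflexive_space TYPE('a::real_normed_vector)" "reflexive_space TYPE('b::real_normed_vector)"
  shows "reflexive_space TYPE('a \<times> 'b)"
  unfolding reflexive_space_def
proof
  fix \<phi> :: "(('a \<times> 'b) \<Rightarrow>\<^sub>L real) \<Rightarrow>\<^sub>L real"
  define pa where "pa = (\<lambda>\<xi> :: 'a \<Rightarrow>\<^sub>L real. \<xi> o\<^sub>L Blinfun (fst :: 'a \<times> 'b \<Rightarrow> 'a))"
  define pb where "pb = (\<lambda>\<xi> :: 'b \<Rightarrow>\<^sub>L real. \<xi> o\<^sub>L Blinfun (snd :: 'a \<times> 'b \<Rightarrow> 'b))"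
  have "bounded_linear (\<lambda>\<xi>. \<phi> (pa \<xi>))" "bounded_linear (\<lambda>\<xi>. \<phi> (pb \<xi>))"
    unfolding pa_def pb_def
    by (intro bounded_linear_compose[OF blinfun.bounded_linear_right]
        bounded_bilinear.bounded_linear_left[OF bounded_bilinear_blinfun_compose])+
  then have *: "blinfun_apply (Blinfun (\<lambda>\<xi>. \<phi> (pa \<xi>))) = (\<lambda>\<xi>. \<phi> (pa \<xi>))"
    "blinfun_apply (Blinfun (\<lambda>\<xi>. \<phi> (pb \<xi>))) = (\<lambda>\<xi>. \<phi> (pb \<xi>))"
    by (auto intro: bounded_linear_Blinfun_apply)
  obtain x where x: "\<And>\<xi>. \<phi> (pa \<xi>) = \<xi> x" using assms(1) * unfolding reflexive_space_def by metis
  obtain y where y: "\<And>\<xi>. \<phi> (pb \<xi>) = \<xi> y" using assms(2) * unfolding reflexive_space_def by metis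
  have "\<phi> \<zeta> = \<zeta> (x, y)" for \<zeta> :: "('a \<times> 'b) \<Rightarrow>\<^sub>L real"
  proof -
    have b1: "bounded_linear (\<lambda>a::'a. (a, 0::'b))" and b2: "bounded_linear (\<lambda>b::'b. (0::'a, b))"
      by (intro bounded_linear_Pair bounded_linear_ident bounded_linear_zero)+
    define \<xi> where "\<xi> = \<zeta> o\<^sub>L Blinfun (\<lambda>a::'a. (a, 0::'b))"
    define \<eta> where "\<eta> = \<zeta> o\<^sub>L Blinfun (\<lambda>b::'b. (0::'a, b))"
    have "\<zeta> = pa \<xi> + pb \<eta>"
    proof (rule blinfun_eqI)
      fix z :: "'a \<times> 'b"
      show "\<zeta> z = (pa \<xi> + pb \<eta>) z"
        by (simp add: pa_def pb_def \<xi>_def \<eta>_def blinfun.add_left bounded_linear_Blinfun_apply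
            bounded_linear_fst bounded_linear_snd b1 b2 blinfun.add_right[symmetric])
    qed
    then have "\<phi> \<zeta> = \<xi> x + \<eta> y" by (simp add: blinfun.add_right x y)
    also have "\<dots> = \<zeta> (x, y)"
      by (simp add: \<xi>_def \<eta>_def bounded_linear_Blinfun_apply b1 b2 blinfun.add_right[symmetric])
    finally show ?thesis .
  qed
  then show "\<exists>x. \<forall>\<xi>. \<phi> \<xi> = \<xi> x" by blast
qed

subsection \<open>The Knaster--Kuratowski--Mazurkiewicz lemma\<close>

lemma tendsto_fun_iff:
  fixes g :: "'b \<Rightarrow> 'i \<Rightarrow> real"
  shows "(g \<longlongrightarrow> l) F \<longleftrightarrow> (\<forall>i. ((\<lambda>n. g n i) \<longlongrightarrow> l i) F)"
  using limitin_componentwise[of "\<lambda>_::'i. euclidean :: real topology" UNIV g l F]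
  by (simp add: euclidean_product_topology)

text \<open>The cube is placed among functions on \<open>nat\<close> vanishing from \<open>n\<close>
  on, so that the dimension is a variable and not a type. Kuhn's combinatorial lemma on finer and
  finer grids gives approximate fixed points, and compactness a limit.\<close>

lemma Brouwer_nat_cube:
  fixes f :: "(nat \<Rightarrow> real) \<Rightarrow> nat \<Rightarrow> real" and n :: nat
  defines "C \<equiv> {x. (\<forall>i. 0 \<le> x i \<and> x i \<le> 1) \<and> (\<forall>i\<ge>n. x i = 0)}"
  assumes cont: "continuous_on C f" and f: "\<And>x i. x \<in> C \<Longrightarrow> i < n \<Longrightarrow> 0 \<le> f x i \<and> f x i \<le> 1"
  shows "\<exists>x\<in>C. \<forall>i<n. f x i = x i"
proof -
  define pt where "pt p x = (\<lambda>i. if i < n then real (x i) / real (Suc p) else 0)" for p and x :: "nat \<Rightarrow> nat"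
  have ptC: "pt p x \<in> C" if "\<forall>i<n. x i \<le> Suc p" for p x
    using that by (auto simp: pt_def C_def simp del: of_nat_Suc)
  have "\<exists>q. q \<in> C \<and> (\<forall>i<n. \<exists>a b. a \<in> C \<and> b \<in> C \<and> a i \<le> f a i \<and> f b i \<le> b i \<and>
      (\<forall>j. \<bar>a j - q j\<bar> \<le> inverse (real (Suc p))) \<and> (\<forall>j. \<bar>b j - q j\<bar> \<le> inverse (real (Suc p))))" for p
  proof -
    \<comment> \<open>Label 0 records that \<open>f\<close> does not decrease coordinate
      \<open>i\<close>, label 1 that it does not increase it. On the two opposite faces the label is
      forced, as Kuhn's lemma requires, and there the inequality holds because \<open>f\<close>
      stays between 0 and 1.\<close>
    define label where "label x i = (if x i = 0 \<or> (x i \<noteq> Suc p \<and> pt p x i \<le> f (pt p x) i) then 0 else 1 :: nat)"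
      for x i
    obtain q where q: "\<forall>i<n. q i < Suc p"
      and rs: "\<forall>i<n. \<exists>r s. (\<forall>j<n. q j \<le> r j \<and> r j \<le> q j + 1) \<and> (\<forall>j<n. q j \<le> s j \<and> s j \<le> q j + 1) \<and> label r i \<noteq> label s i"
      by (rule kuhn_lemma[of "Suc p" n label]) (auto simp: label_def)
    have near: "\<bar>pt p r j - pt p q j\<bar> \<le> inverse (real (Suc p))" if "\<forall>j<n. q j \<le> r j \<and> r j \<le> q j + 1" for r j
    proof (cases "j < n")
      case True
      have "pt p r j - pt p q j = (real (r j) - real (q j)) * inverse (real (Suc p))"
        using True by (simp add: pt_def left_diff_distrib divide_inverse del: of_nat_Suc)
      moreover have "\<bar>real (r j) - real (q j)\<bar> \<le> 1" using that True by (auto simp: abs_le_iff)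
      ultimately show ?thesis by (simp add: abs_mult mult_left_le_one_le)
    qed (simp add: pt_def)
    have "\<exists>a b. a \<in> C \<and> b \<in> C \<and> a i \<le> f a i \<and> f b i \<le> b i \<and>
      (\<forall>j. \<bar>a j - pt p q j\<bar> \<le> inverse (real (Suc p))) \<and> (\<forall>j. \<bar>b j - pt p q j\<bar> \<le> inverse (real (Suc p)))"
      if i: "i < n" for i
    proof -
      obtain r s where r: "\<forall>j<n. q j \<le> r j \<and> r j \<le> q j + 1" and s: "\<forall>j<n. q j \<le> s j \<and> s j \<le> q j + 1"
        and l: "label r i = 0" "label s i = 1"
      proof -
        obtain r s where *: "\<forall>j<n. q j \<le> r j \<and> r j \<le> q j + 1" "\<forall>j<n. q j \<le> s j \<and> s j \<le> q j + 1"
          "label r i \<noteq> label s i" using rs i by blast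
        then have "label r i = 0 \<and> label s i = 1 \<or> label s i = 0 \<and> label r i = 1"
          by (auto simp: label_def split: if_splits)
        then show ?thesis using that * by blast
      qed
      have C: "pt p r \<in> C" "pt p s \<in> C"
        using r s q by (auto intro!: ptC) (metis Suc_leI add.commute le_trans plus_1_eq_Suc)+
      have "pt p r i \<le> f (pt p r) i"
        using l(1) f[OF C(1) i] i by (auto simp: label_def pt_def split: if_splits)
      moreover have "f (pt p s) i \<le> pt p s i"
        using l(2) f[OF C(2) i] i by (auto simp: label_def pt_def simp del: of_nat_Suc split: if_splits)
      ultimately show ?thesis using C near r s by blast
    qed
    moreover have "pt p q \<in> C" using q by (auto intro!: ptC)
    ultimately show ?thesis by blast
  qed
  then obtain q where qC: "\<And>p. q p \<in> C" and q: "\<And>p i. i < n \<Longrightarrow> \<exists>a b. a \<in> C \<and> b \<in> C \<and> a i \<le> f a i \<and> f b i \<le> b i \<and>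
      (\<forall>j. \<bar>a j - q p j\<bar> \<le> inverse (real (Suc p))) \<and> (\<forall>j. \<bar>b j - q p j\<bar> \<le> inverse (real (Suc p)))"
    by metis
  have "closed C" unfolding C_def
    by (intro closed_Collect_conj closed_Collect_all closed_Collect_imp open_Collect_const closed_Collect_le closed_Collect_eq
        continuous_intros continuous_on_product_coordinates)
  then have "compact ({x. \<forall>i. \<bar>x i\<bar> \<le> 1} \<inter> C)" using compact_box by (rule compact_Int_closed[rotated])
  also have "{x. \<forall>i. \<bar>x i\<bar> \<le> 1} \<inter> C = C" by (auto simp: C_def)
  finally have "seq_compact C" by (simp add: compact_eq_seq_compact_metric)
  then obtain x r where x: "x \<in> C" "strict_mono r" "(q \<circ> r) \<longlonglongrightarrow> x"
    using qC unfolding seq_compact_def by metis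
  \<comment> \<open>Points within the mesh size of \<open>q (r k)\<close> share its limit
    \<open>x\<close>, so the opposite inequalities at the two kinds of nearby points both pass to
    \<open>x\<close>.\<close>
  have limC: "(\<lambda>k. a k i) \<longlonglongrightarrow> x i" "(\<lambda>k. f (a k) i) \<longlonglongrightarrow> f x i"
    if aC: "\<And>k. a k \<in> C" and a: "\<And>k j. \<bar>a k j - q (r k) j\<bar> \<le> inverse (real (Suc (r k)))" for a i
  proof -
    have "(\<lambda>k. inverse (real (Suc (r k)))) \<longlonglongrightarrow> 0"
      using LIMSEQ_subseq_LIMSEQ[OF LIMSEQ_inverse_real_of_nat x(2)] by (simp add: o_def)
    then have "(\<lambda>k. a k j - q (r k) j) \<longlonglongrightarrow> 0" for j
      by (rule Lim_null_comparison[rotated]) (use a in auto)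
    moreover have "(\<lambda>k. q (r k) j) \<longlonglongrightarrow> x j" for j
      using x(3) unfolding tendsto_fun_iff by (simp add: o_def)
    ultimately have "(\<lambda>k. a k j) \<longlonglongrightarrow> x j" for j by (rule Lim_transform[rotated])
    then have ax: "a \<longlonglongrightarrow> x" and "(\<lambda>k. a k i) \<longlonglongrightarrow> x i" by (simp_all add: tendsto_fun_iff)
    have "(f \<circ> a) \<longlonglongrightarrow> f x"
      using cont ax aC x(1) unfolding continuous_on_sequentially by blast
    then show "(\<lambda>k. f (a k) i) \<longlonglongrightarrow> f x i" unfolding tendsto_fun_iff by (simp add: o_def)
    show "(\<lambda>k. a k i) \<longlonglongrightarrow> x i" by fact
  qed
  have "f x i = x i" if i: "i < n" for i
  proof -
    have "\<exists>a. \<forall>k. a k \<in> C \<and> a k i \<le> f (a k) i \<and> (\<forall>j. \<bar>a k j - q (r k) j\<bar> \<le> inverse (real (Suc (r k))))"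
      by (intro choice allI) (use q[OF i] in blast)
    then obtain a where a: "\<And>k. a k \<in> C" "\<And>k. a k i \<le> f (a k) i" "\<And>k j. \<bar>a k j - q (r k) j\<bar> \<le> inverse (real (Suc (r k)))"
      by blast
    have "\<exists>b. \<forall>k. b k \<in> C \<and> f (b k) i \<le> b k i \<and> (\<forall>j. \<bar>b k j - q (r k) j\<bar> \<le> inverse (real (Suc (r k))))"
      by (intro choice allI) (use q[OF i] in blast)
    then obtain b where b: "\<And>k. b k \<in> C" "\<And>k. f (b k) i \<le> b k i" "\<And>k j. \<bar>b k j - q (r k) j\<bar> \<le> inverse (real (Suc (r k)))"
      by blast
    have "x i \<le> f x i" 
      by (rule LIMSEQ_le[OF limC(1)[OF a(1,3)] limC(2)[OF a(1,3)]]) (use a(2) in blast)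
    moreover have "f x i \<le> x i" 
      by (rule LIMSEQ_le[OF limC(2)[OF b(1,3)] limC(1)[OF b(1,3)]]) (use b(2) in blast)
    ultimately show ?thesis by simp
  qed
  with x(1) show ?thesis by blast
qed

text \<open>Apply Brouwer to the map of the simplex that moves mass towards the vertices whose sets do
  not contain the point, composed with a retraction of the cube onto the simplex.\<close>

lemma KKM_nat_simplex:
  fixes F :: "nat \<Rightarrow> (nat \<Rightarrow> real) set" and n :: nat
  defines "S \<equiv> {x. (\<forall>i. 0 \<le> x i) \<and> (\<forall>i\<ge>n. x i = 0) \<and> (\<Sum>i<n. x i) = 1}"
  assumes "n > 0" and F: "\<And>i. i < n \<Longrightarrow> closed (F i)"
    and cover: "\<And>x. x \<in> S \<Longrightarrow> \<exists>i<n. x i > 0 \<and> x \<in> F i"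
  shows "\<exists>x\<in>S. \<forall>i<n. x \<in> F i"
proof (rule ccontr)
  assume contra: "\<not> (\<exists>x\<in>S. \<forall>i<n. x \<in> F i)"
  define D where "D x = (\<Sum>i<n. infdist x (F i))" for x
  \<comment> \<open>The covering condition at vertex \<open>i\<close> puts that vertex into
    \<open>F i\<close>. Nonemptiness matters because \<open>infdist\<close> to the empty set is
    0.\<close>
  have F_ne: "F i \<noteq> {}" if "i < n" for i
  proof -
    have "(\<lambda>j. if j = i then 1 else 0) \<in> S" using that by (auto simp: S_def)
    from cover[OF this] show ?thesis by (auto split: if_splits)
  qed
  have D_pos: "D x > 0" if "x \<in> S" for x
  proof -
    have "\<exists>i<n. x \<notin> F i" using contra that by blast
    then obtain i where i: "i < n" "x \<notin> F i" by blast
    then have "infdist x (F i) > 0" by (intro infdist_pos_not_in_closed F F_ne)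
    then show ?thesis unfolding D_def using i by (intro sum_pos2[of _ i]) (auto simp: infdist_nonneg)
  qed
  \<comment> \<open>Missing mass is spread evenly over the coordinates and excess mass is removed by
    scaling; points of the simplex are fixed.\<close>
  define R where "R y = (\<lambda>i. if i < n then (y i + max 0 (1 - (\<Sum>j<n. y j)) / n) / max 1 (\<Sum>j<n. y j) else 0)"
    for y :: "nat \<Rightarrow> real"
  have RS: "R y \<in> S" if "\<And>i. 0 \<le> y i" for y
  proof -
    have "(\<Sum>i<n. R y i) = ((\<Sum>i<n. y i) + max 0 (1 - (\<Sum>j<n. y j))) / max 1 (\<Sum>j<n. y j)"
      using \<open>n > 0\<close> by (simp add: R_def sum_divide_distrib[symmetric] sum.distrib)
    also have "\<dots> = 1" by (simp add: max_def)
    finally show ?thesis using that by (simp add: S_def R_def)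
  qed
  define g where "g y = (\<lambda>i. if i < n then infdist (R y) (F i) / D (R y) else 0)" for y
  define C where "C = {x :: nat \<Rightarrow> real. (\<forall>i. 0 \<le> x i \<and> x i \<le> 1) \<and> (\<forall>i\<ge>n. x i = 0)}"
  have max1: "max 1 s \<noteq> 0" for s :: real by linarith
  have R_cont: "continuous_on C R"
    unfolding R_def
  proof (rule continuous_on_coordinatewise_then_product)
    fix i show "continuous_on C (\<lambda>y. if i < n then (y i + max 0 (1 - (\<Sum>j<n. y j)) / n) / max 1 (\<Sum>j<n. y j) else 0)"
      using \<open>n > 0\<close> max1 by (cases "i < n")
        (auto intro!: continuous_intros continuous_on_product_then_coordinatewise[OF continuous_on_id])
  qed
  have DR: "D (R y) > 0" if "y \<in> C" for y using that by (intro D_pos RS) (auto simp: C_def)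
  have "\<exists>y\<in>C. \<forall>i<n. g y i = y i"
  proof (rule Brouwer_nat_cube[where f = g and n = n, folded C_def])
    show "continuous_on C g"
      unfolding g_def
    proof (rule continuous_on_coordinatewise_then_product)
      fix i show "continuous_on C (\<lambda>y. if i < n then infdist (R y) (F i) / D (R y) else 0)"
        using DR by (cases "i < n") (force simp: D_def intro!: continuous_intros R_cont)+
    qed
    fix y i assume y: "y \<in> C" and i: "i < n"
    have "infdist (R y) (F i) \<le> D (R y)"
      unfolding D_def using i by (intro member_le_sum) (auto simp: infdist_nonneg)
    then show "0 \<le> g y i \<and> g y i \<le> 1" using DR[OF y] i by (simp add: g_def infdist_nonneg)
  qed
  then obtain y where y: "y \<in> C" "\<And>i. i < n \<Longrightarrow> g y i = y i" by blast
  have "(\<Sum>i<n. y i) = (\<Sum>i<n. g y i)" using y(2) by simp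
  also have "\<dots> = 1" using DR[OF y(1)] by (simp add: g_def sum_divide_distrib[symmetric] D_def[symmetric])
  finally have sum1: "(\<Sum>i<n. y i) = 1" .
  then have yS: "y \<in> S" and "R y = y" using y(1) by (auto simp: S_def C_def R_def)
  \<comment> \<open>At a fixed point each coordinate is the share of the distance to the
    corresponding set. The covering condition selects a positive coordinate whose set contains the
    point, and its share is 0.\<close>
  obtain i where i: "i < n" "y i > 0" "y \<in> F i" using cover[OF yS] by blast
  then have "g y i = 0" using \<open>R y = y\<close> by (simp add: g_def)
  with i y(2) show False by simp
qed

text \<open>The sets are pulled back to the standard simplex along the barycentric map. The covering
  condition speaks of coefficients and not of faces because the points of \<open>P\<close> may be
  affinely dependent.\<close>

lemma KKM_convex_hull:
  fixes P :: "'a::real_normed_vector set"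
  assumes "finite P" "P \<noteq> {}" and closed: "\<And>p. p \<in> P \<Longrightarrow> closed (convex hull P \<inter> G p)"
    and cover: "\<And>c. (\<And>p. p \<in> P \<Longrightarrow> 0 \<le> c p) \<Longrightarrow> sum c P = 1 \<Longrightarrow> \<exists>p\<in>P. c p > 0 \<and> (\<Sum>q\<in>P. c q *\<^sub>R q) \<in> G p"
  shows "convex hull P \<inter> (\<Inter>p\<in>P. G p) \<noteq> {}"
proof -
  define n where "n = card P"
  obtain p where p: "bij_betw p {..<n} P"
    using ex_bij_betw_nat_finite[OF \<open>finite P\<close>] by (auto simp: n_def atLeast0LessThan)
  define e where "e = inv_into {..<n} p"
  have ep: "e (p i) = i" if "i < n" for i
    unfolding e_def using that p by (simp add: bij_betw_inv_into_left)
  have pP: "p i \<in> P" if "i < n" for i using that p by (auto simp: bij_betw_def)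
  have re: "(\<Sum>q\<in>P. \<phi> (e q) q) = (\<Sum>i<n. \<phi> i (p i))" for \<phi> :: "nat \<Rightarrow> 'a \<Rightarrow> 'b::comm_monoid_add"
    using sum.reindex_bij_betw[OF p, of "\<lambda>q. \<phi> (e q) q"] by (simp add: ep)
  define X where "X x = (\<Sum>i<n. x i *\<^sub>R p i)" for x :: "nat \<Rightarrow> real"
  have X_cont: "continuous_on UNIV X"
    unfolding X_def by (intro continuous_intros continuous_on_product_coordinates)
  define S where "S = {x :: nat \<Rightarrow> real. (\<forall>i. 0 \<le> x i) \<and> (\<forall>i\<ge>n. x i = 0) \<and> (\<Sum>i<n. x i) = 1}"
  have XS: "X x \<in> convex hull P" if "x \<in> S" for x
    unfolding X_def using that pP
    by (intro convex_sum) (auto simp: S_def intro: hull_inc)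
  have "\<exists>x\<in>S. \<forall>i<n. x \<in> X -` (convex hull P \<inter> G (p i))"
  proof (rule KKM_nat_simplex[where F = "\<lambda>i. X -` (convex hull P \<inter> G (p i))" and n = n, folded S_def])
    show "n > 0" using \<open>finite P\<close> \<open>P \<noteq> {}\<close> by (simp add: n_def card_gt_0_iff)
    show "closed (X -` (convex hull P \<inter> G (p i)))" if "i < n" for i
      using closed_vimage[OF closed[OF pP[OF that]] X_cont] .
    fix x assume x: "x \<in> S"
    have "\<exists>q\<in>P. x (e q) > 0 \<and> (\<Sum>q\<in>P. x (e q) *\<^sub>R q) \<in> G q"
      using x re[of "\<lambda>i _. x i"] by (intro cover) (auto simp: S_def)
    then obtain q where q: "q \<in> P" "x (e q) > 0" "X x \<in> G q"
      using re[of "\<lambda>i q. x i *\<^sub>R q"] by (auto simp: X_def)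
    obtain i where "i < n" "q = p i" using q(1) p by (auto simp: bij_betw_def)
    then show "\<exists>i<n. x i > 0 \<and> x \<in> X -` (convex hull P \<inter> G (p i))"
      using q XS[OF x] by (auto simp: ep)
  qed
  then obtain x where "x \<in> S" "\<And>i. i < n \<Longrightarrow> X x \<in> G (p i)" by blast
  then have "X x \<in> convex hull P \<inter> (\<Inter>p\<in>P. G p)" using XS p by (auto simp: bij_betw_def)
  then show ?thesis by blast
qed

subsection \<open>The Clarke derivative\<close>

text \<open>A real-valued form to which the Hahn-Banach lemmas apply. For locally Lipschitz
  \<open>J\<close> the upper limit is finite and the conversion loses nothing.\<close>

definition clarke :: "('a::real_normed_vector \<Rightarrow> real) \<Rightarrow> 'a \<Rightarrow> 'a \<Rightarrow> real" where
  "clarke J x z = real_of_ereal (clarke_deriv J x z)"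

lemma clarke_deriv_lessD:
  assumes "clarke_deriv J x z < ereal c"
  obtains \<delta> where "\<delta> > 0"
    "\<And>t y. 0 < t \<Longrightarrow> t < \<delta> \<Longrightarrow> dist y x < \<delta> \<Longrightarrow> (J (y + t *\<^sub>R z) - J y) / t < c"
proof -
  have "eventually (\<lambda>(t, y). (J (y + t *\<^sub>R z) - J y) / t < c) (at_right 0 \<times>\<^sub>F nhds x)"
    using Limsup_lessD[OF assms[unfolded clarke_deriv_def]] by eventually_elim auto
  then obtain P Q where P: "eventually P (at_right (0::real))" and Q: "eventually Q (nhds x)"
    and PQ: "\<And>t y. P t \<Longrightarrow> Q y \<Longrightarrow> (J (y + t *\<^sub>R z) - J y) / t < c"
    unfolding eventually_prod_filter by auto
  obtain d1 where d1: "d1 > 0" "\<And>t. 0 < t \<Longrightarrow> t < d1 \<Longrightarrow> P t"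
    using P unfolding eventually_at_right_field by auto
  obtain d2 where d2: "d2 > 0" "\<And>y. dist y x < d2 \<Longrightarrow> Q y"
    using Q unfolding eventually_nhds_metric by auto
  show ?thesis
    by (rule that[of "min d1 d2"]) (use d1 d2 PQ in auto)
qed

lemma clarke_deriv_leI:
  assumes "\<delta> > 0"
    and "\<And>t y. 0 < t \<Longrightarrow> t < \<delta> \<Longrightarrow> dist y x < \<delta> \<Longrightarrow> (J (y + t *\<^sub>R z) - J y) / t \<le> c"
  shows "clarke_deriv J x z \<le> ereal c"
  unfolding clarke_deriv_def
proof (rule Limsup_bounded)
  show "eventually (\<lambda>ty. (case ty of (t, y) \<Rightarrow> ereal ((J (y + t *\<^sub>R z) - J y) / t)) \<le> ereal c)
      (at_right 0 \<times>\<^sub>F nhds x)"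
    unfolding eventually_prod_filter
  proof (intro exI conjI allI impI)
    show "eventually (\<lambda>t. 0 < t \<and> t < \<delta>) (at_right (0::real))"
      using assms(1) by (auto simp: eventually_at_right_field)
    show "eventually (\<lambda>y. dist y x < \<delta>) (nhds x)"
      using assms(1) by (auto simp: eventually_nhds_metric)
  qed (use assms(2) in auto)
qed

lemma clarke_deriv_geI:
  assumes "\<delta> > 0"
    and "\<And>t y. 0 < t \<Longrightarrow> t < \<delta> \<Longrightarrow> dist y x < \<delta> \<Longrightarrow> c \<le> (J (y + t *\<^sub>R z) - J y) / t"
  shows "ereal c \<le> clarke_deriv J x z"
  unfolding clarke_deriv_def
proof (rule le_Limsup)
  show "at_right (0::real) \<times>\<^sub>F nhds x \<noteq> bot" by (simp add: prod_filter_eq_bot)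
  show "eventually (\<lambda>ty. ereal c \<le> (case ty of (t, y) \<Rightarrow> ereal ((J (y + t *\<^sub>R z) - J y) / t)))
      (at_right 0 \<times>\<^sub>F nhds x)"
    unfolding eventually_prod_filter
  proof (intro exI conjI allI impI)
    show "eventually (\<lambda>t. 0 < t \<and> t < \<delta>) (at_right (0::real))"
      using assms(1) by (auto simp: eventually_at_right_field)
    show "eventually (\<lambda>y. dist y x < \<delta>) (nhds x)"
      using assms(1) by (auto simp: eventually_nhds_metric)
  qed (use assms(2) in auto)
qed

lemma clarke_deriv_lipschitz:
  assumes "locally_lipschitz J"
  obtains L where "\<And>z. \<bar>clarke_deriv J x z\<bar> \<le> ereal (L * norm z)"
proof -
  obtain r L where r: "r > 0" and L: "L-lipschitz_on (ball x r) J"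
    using assms unfolding locally_lipschitz_def by blast
  have "\<bar>clarke_deriv J x z\<bar> \<le> ereal (L * norm z)" for z
  proof -
    \<comment> \<open>Chosen so that \<open>\<delta> + \<delta> * norm z = r\<close>, which keeps
      both \<open>y\<close> and the displaced point in the ball where \<open>J\<close> is
      Lipschitz.\<close>
    define \<delta> where "\<delta> = r / (norm z + 1)"
    have z1: "norm z + 1 > 0" by (simp add: add_nonneg_pos)
    have \<delta>: "\<delta> > 0" using r z1 by (simp add: \<delta>_def)
    have q: "\<bar>(J (y + t *\<^sub>R z) - J y) / t\<bar> \<le> L * norm z" if "0 < t" "t < \<delta>" "dist y x < \<delta>" for t y
    proof -
      have "t * norm z \<le> \<delta> * norm z" using that by (intro mult_right_mono) auto
      moreover have "\<delta> + \<delta> * norm z = \<delta> * (norm z + 1)" by (simp add: algebra_simps)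
      then have "\<delta> + \<delta> * norm z = r" using z1 by (simp add: \<delta>_def)
      moreover have "dist (y + t *\<^sub>R z) y = t * norm z" using that(1) by (simp add: dist_norm)
      moreover have "0 \<le> t * norm z" using that(1) by simp
      ultimately have "y \<in> ball x r" "y + t *\<^sub>R z \<in> ball x r"
        using that(3) dist_triangle[of "y + t *\<^sub>R z" x y] by (auto simp: dist_commute)
      then have "\<bar>J (y + t *\<^sub>R z) - J y\<bar> \<le> L * (t * norm z)"
        using lipschitz_onD[OF L, of "y + t *\<^sub>R z" y] that(1) by (simp add: dist_norm)
      then show ?thesis using that(1) by (simp add: field_simps)
    qed
    have "clarke_deriv J x z \<le> ereal (L * norm z)"
      by (rule clarke_deriv_leI[OF \<delta>]) (use q in \<open>blast intro: order_trans[OF abs_ge_self]\<close>)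
    moreover have "ereal (- (L * norm z)) \<le> clarke_deriv J x z"
      by (rule clarke_deriv_geI[OF \<delta>]) (use q in \<open>simp only: abs_le_iff minus_le_iff\<close>)
    ultimately show ?thesis by (cases "clarke_deriv J x z") auto
  qed
  with that show ?thesis by blast
qed

lemma clarke_deriv_eq_clarke:
  assumes "locally_lipschitz J"
  shows "clarke_deriv J x z = ereal (clarke J x z)"
proof -
  obtain L where "\<bar>clarke_deriv J x z\<bar> \<le> ereal (L * norm z)"
    using clarke_deriv_lipschitz[OF assms] by blast
  then show ?thesis by (cases "clarke_deriv J x z") (auto simp: clarke_def)
qed

lemma clarke_le_norm:
  assumes "locally_lipschitz J"
  obtains L where "\<And>z. clarke J x z \<le> L * norm z"
proof -
  obtain L where L: "\<And>z. \<bar>clarke_deriv J x z\<bar> \<le> ereal (L * norm z)"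
    using clarke_deriv_lipschitz[OF assms] by blast
  have "clarke J x z \<le> L * norm z" for z
    using L[of z] by (simp add: clarke_deriv_eq_clarke[OF assms])
  with that show ?thesis by blast
qed

lemma clarke_lessD:
  assumes "locally_lipschitz J" "clarke J x z < c"
  obtains \<delta> where "\<delta> > 0"
    "\<And>t y. 0 < t \<Longrightarrow> t < \<delta> \<Longrightarrow> dist y x < \<delta> \<Longrightarrow> (J (y + t *\<^sub>R z) - J y) / t < c"
  using clarke_deriv_lessD[of J x z c] assms by (auto simp: clarke_deriv_eq_clarke)

lemma clarke_leI:
  assumes "locally_lipschitz J" "\<delta> > 0"
    and "\<And>t y. 0 < t \<Longrightarrow> t < \<delta> \<Longrightarrow> dist y x < \<delta> \<Longrightarrow> (J (y + t *\<^sub>R z) - J y) / t \<le> c"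
  shows "clarke J x z \<le> c"
  using clarke_deriv_leI[OF assms(2,3)] by (simp add: clarke_deriv_eq_clarke[OF assms(1)])

text \<open>For subadditivity the quotient is split at the intermediate point reached in direction
  \<open>z\<close>; this is again a base point near \<open>x\<close>, and the upper limit ranges
  over such points. Homogeneity is a rescaling of \<open>t\<close>.\<close>

lemma sublinear_clarke:
  assumes J: "locally_lipschitz J"
  shows "sublinear (clarke J x)"
proof (rule sublinearI)
  fix z w
  show "clarke J x (z + w) \<le> clarke J x z + clarke J x w"
  proof (rule field_le_epsilon)
    fix e :: real assume e: "e > 0"
    obtain d1 where d1: "d1 > 0" "\<And>t y. 0 < t \<Longrightarrow> t < d1 \<Longrightarrow> dist y x < d1 \<Longrightarrow>
        (J (y + t *\<^sub>R z) - J y) / t < clarke J x z + e / 2"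
      by (rule clarke_lessD[OF J, of x z "clarke J x z + e / 2"]) (use e in auto)
    obtain d2 where d2: "d2 > 0" "\<And>t y. 0 < t \<Longrightarrow> t < d2 \<Longrightarrow> dist y x < d2 \<Longrightarrow>
        (J (y + t *\<^sub>R w) - J y) / t < clarke J x w + e / 2"
      by (rule clarke_lessD[OF J, of x w "clarke J x w + e / 2"]) (use e in auto)
    \<comment> \<open>The second bound keeps the intermediate base point within \<open>d2\<close> of
      \<open>x\<close>.\<close>
    define \<delta> where "\<delta> = min d1 (d2 / (norm z + 1))"
    have z1: "norm z + 1 > 0" by (simp add: add_nonneg_pos)
    show "clarke J x (z + w) \<le> clarke J x z + clarke J x w + e"
    proof (rule clarke_leI[OF J, of \<delta>])
      show "\<delta> > 0" using d1(1) d2(1) z1 by (simp add: \<delta>_def)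
      fix t y assume t: "0 < t" "t < \<delta>" and y: "dist y x < \<delta>"
      have s: "\<delta> * (norm z + 1) \<le> d2"
        using z1 pos_le_divide_eq[of "norm z + 1" \<delta> d2] by (simp add: \<delta>_def)
      have "t * norm z \<le> \<delta> * norm z" using t by (intro mult_right_mono) auto
      then have "dist (y + t *\<^sub>R z) x < \<delta> * (norm z + 1)"
        using t y dist_triangle[of "y + t *\<^sub>R z" x y] by (simp add: dist_norm algebra_simps)
      then have y2: "dist (y + t *\<^sub>R z) x < d2" using s by simp
      have "0 \<le> \<delta> * norm z" using \<open>\<delta> > 0\<close> by simp
      then have "\<delta> \<le> d2" using s by (simp add: distrib_left)
      have "(J ((y + t *\<^sub>R z) + t *\<^sub>R w) - J (y + t *\<^sub>R z)) / t < clarke J x w + e / 2"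
        using t y2 \<open>\<delta> \<le> d2\<close> by (intro d2) auto
      moreover have "(J (y + t *\<^sub>R z) - J y) / t < clarke J x z + e / 2"
        using t y by (intro d1) (auto simp: \<delta>_def)
      moreover have "(J (y + t *\<^sub>R (z + w)) - J y) / t =
          (J ((y + t *\<^sub>R z) + t *\<^sub>R w) - J (y + t *\<^sub>R z)) / t + (J (y + t *\<^sub>R z) - J y) / t"
        by (simp add: add_divide_distrib[symmetric] scaleR_add_right add.assoc)
      ultimately show "(J (y + t *\<^sub>R (z + w)) - J y) / t \<le> clarke J x z + clarke J x w + e" by simp
    qed
  qed
next
  show "clarke J x 0 = 0" by (simp add: clarke_def clarke_deriv_zero)
next
  fix c :: real and z assume c: "c > 0"
  show "clarke J x (c *\<^sub>R z) \<le> c * clarke J x z"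
  proof (rule field_le_epsilon)
    fix e :: real assume e: "e > 0"
    obtain d where d: "d > 0" "\<And>t y. 0 < t \<Longrightarrow> t < d \<Longrightarrow> dist y x < d \<Longrightarrow>
        (J (y + t *\<^sub>R z) - J y) / t < clarke J x z + e / c"
      by (rule clarke_lessD[OF J, of x z "clarke J x z + e / c"]) (use e c in auto)
    show "clarke J x (c *\<^sub>R z) \<le> c * clarke J x z + e"
    proof (rule clarke_leI[OF J, of "min d (d / c)"])
      show "min d (d / c) > 0" using c d by simp
      fix t y assume "0 < t" "t < min d (d / c)" "dist y x < min d (d / c)"
      then have "(J (y + (t * c) *\<^sub>R z) - J y) / (t * c) < clarke J x z + e / c"
        using c by (intro d) (auto simp: field_simps)
      then have "c * ((J (y + (t * c) *\<^sub>R z) - J y) / (t * c)) < c * (clarke J x z + e / c)"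
        using c by (rule mult_strict_left_mono)
      then show "(J (y + t *\<^sub>R (c *\<^sub>R z)) - J y) / t \<le> c * clarke J x z + e"
        using c by (simp add: distrib_left)
    qed
  qed
qed

text \<open>A strict bound on the quotients with base points within \<open>d\<close> of
  \<open>x\<close> holds within \<open>d / 2\<close> of every \<open>y\<close> at distance less than
  \<open>d / 2\<close>.\<close>

lemma clarke_upper_semicontinuous:
  assumes J: "locally_lipschitz J" and "clarke J x z < c"
  shows "eventually (\<lambda>y. clarke J y z \<le> c) (nhds x)"
proof -
  obtain d where d: "d > 0" "\<And>t y. 0 < t \<Longrightarrow> t < d \<Longrightarrow> dist y x < d \<Longrightarrow> (J (y + t *\<^sub>R z) - J y) / t < c"
    using clarke_lessD[OF assms] by blast
  have "clarke J y z \<le> c" if "dist y x < d / 2" for y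
  proof (rule clarke_leI[OF J, of "d / 2"])
    fix t y' assume "0 < t" "t < d / 2" "dist y' y < d / 2"
    moreover from this have "dist y' x < d" using that dist_triangle[of y' x y] by simp
    ultimately show "(J (y' + t *\<^sub>R z) - J y') / t \<le> c" using d(2)[of t y'] by simp
  qed (use d in simp)
  then show ?thesis using d(1) unfolding eventually_nhds_metric by (intro exI[of _ "d / 2"]) auto
qed

lemma clarke_gradient_iff:
  assumes "locally_lipschitz J"
  shows "\<xi> \<in> clarke_gradient J x \<longleftrightarrow> (\<forall>z. \<xi> z \<le> clarke J x z)"
  by (simp add: clarke_gradient_def clarke_deriv_eq_clarke[OF assms])

text \<open>Hahn-Banach for the sublinear map \<open>clarke J x\<close> with the singleton
  \<open>{z}\<close>. It also shows that the gradient is nonempty, and it exchanges the nonsmooth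
  term for a dual pairing.\<close>

lemma clarke_attained:
  assumes J: "locally_lipschitz J"
  obtains \<xi> where "\<xi> \<in> clarke_gradient J x" "\<xi> z = clarke J x z"
proof -
  obtain L where "\<And>z. clarke J x z \<le> L * norm z" using clarke_le_norm[OF J] by blast
  then obtain \<xi> :: "'a \<Rightarrow>\<^sub>L real" where \<xi>: "\<And>y. \<xi> y \<le> clarke J x y" "\<And>k. k \<in> {z} \<Longrightarrow> clarke J x z \<le> \<xi> k"
    using Hahn_Banach_blinfun[OF sublinear_clarke[OF J], of x L "{z}" "clarke J x z"] by auto
  then have "\<xi> z = clarke J x z" by (simp add: order_antisym)
  moreover have "\<xi> \<in> clarke_gradient J x" using \<xi>(1) by (simp add: clarke_gradient_iff[OF J])
  ultimately show ?thesis using that by blast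
qed

subsection \<open>The mixed problem on a bounded set\<close>

text \<open>On the hull of finitely many points the norm-closed version applies, since weakly
  sequentially closed sets are norm closed. Weak compactness extends the intersection to all of
  \<open>K\<close>.\<close>

lemma weak_KKM:
  fixes K :: "'a::real_normed_vector set"
  assumes refl: "reflexive_space TYPE('a)" and K: "bounded K" "convex K" "closed K" "K \<noteq> {}"
    and G: "\<And>p. p \<in> K \<Longrightarrow> weakly_seq_closed (G p)"
    and cover: "\<And>P c. finite P \<Longrightarrow> P \<subseteq> K \<Longrightarrow> (\<And>p. p \<in> P \<Longrightarrow> 0 \<le> c p) \<Longrightarrow> sum c P = 1 \<Longrightarrow>
      \<exists>p\<in>P. c p > 0 \<and> (\<Sum>q\<in>P. c q *\<^sub>R q) \<in> G p"
  shows "\<exists>x\<in>K. \<forall>p\<in>K. x \<in> G p"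
proof -
  have Kw: "weakly_seq_closed K" using K by (intro weakly_seq_closed_convex)
  have "K \<inter> (\<Inter>p\<in>K. G p) \<noteq> {}"
  proof (rule weakly_seq_closed_fip[OF refl K(1) Kw])
    show "weakly_seq_closed (K \<inter> G p)" if "p \<in> K" for p
      using Kw G[OF that] unfolding weakly_seq_closed_def by blast
    fix P assume P: "finite P" "P \<subseteq> K"
    show "K \<inter> (\<Inter>p\<in>P. G p) \<noteq> {}"
    proof (cases "P = {}")
      case False
      have "convex hull P \<inter> (\<Inter>p\<in>P. G p) \<noteq> {}"
      proof (rule KKM_convex_hull[OF P(1) False])
        fix p assume "p \<in> P"
        have "closed (convex hull P)"
          by (intro compact_imp_closed finite_imp_compact_convex_hull P)
        moreover have "closed (G p)"
          unfolding closed_sequential_limits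
        proof (intro allI impI)
          fix s x assume s: "(\<forall>n. s n \<in> G p) \<and> s \<longlonglongrightarrow> x"
          have "weakly_converges_to s x"
            unfolding weakly_converges_to_def using s by (auto intro: blinfun.tendsto)
          then show "x \<in> G p" using G \<open>p \<in> P\<close> P(2) s unfolding weakly_seq_closed_def by blast
        qed
        ultimately show "closed (convex hull P \<inter> G p)" by (rule closed_Int)
      qed (rule cover[OF P])
      moreover have "convex hull P \<subseteq> K" using P(2) K(2) by (rule hull_minimal)
      ultimately show ?thesis by blast
    qed (use K in simp)
  qed
  then show ?thesis by blast
qed

lemma weakly_converges_bounded_linear:
  assumes "weakly_converges_to s x" "bounded_linear g"
  shows "(\<lambda>n. g (s n) :: real) \<longlonglongrightarrow> g x"
  using assms(1) bounded_linear_Blinfun_apply[OF assms(2)]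
  unfolding weakly_converges_to_def by metis

text \<open>Along a weakly convergent sequence the affine side converges, while h2 bounds
  \<open>h\<close> at the limit by the upper limit of its values.\<close>

lemma weakly_seq_closed_Minty_set:
  fixes h :: "'v::real_normed_vector \<Rightarrow> real" and g :: "'v \<times> 'e::real_normed_vector \<Rightarrow> real"
  assumes h2: "\<And>s v. weakly_converges_to s v \<Longrightarrow> ereal (h v) \<le> limsup (\<lambda>n. ereal (h (s n)))"
    and g: "bounded_linear g"
  shows "weakly_seq_closed {x. h (fst x - v) \<le> g x + c}"
  unfolding weakly_seq_closed_def
proof (intro allI impI)
  fix s x assume s: "\<forall>n. s n \<in> {x. h (fst x - v) \<le> g x + c}" "weakly_converges_to s x"
  have "weakly_converges_to (\<lambda>n. fst (s n) - v) (fst x - v)"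
    unfolding weakly_converges_to_def
  proof
    fix \<xi> :: "'v \<Rightarrow>\<^sub>L real"
    have "(\<lambda>n. \<xi> (fst (s n))) \<longlonglongrightarrow> \<xi> (fst x)"
      by (rule weakly_converges_bounded_linear[OF s(2)])
        (intro bounded_linear_compose[OF blinfun.bounded_linear_right] bounded_linear_fst)
    then show "(\<lambda>n. \<xi> (fst (s n) - v)) \<longlonglongrightarrow> \<xi> (fst x - v)"
      unfolding blinfun.diff_right by (rule tendsto_diff[OF _ tendsto_const])
  qed
  then have "ereal (h (fst x - v)) \<le> limsup (\<lambda>n. ereal (h (fst (s n) - v)))" by (rule h2)
  also have "\<dots> \<le> limsup (\<lambda>n. ereal (g (s n) + c))"
    using s(1) by (intro Limsup_mono always_eventually) auto
  also have "\<dots> = ereal (g x + c)"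
    by (intro lim_imp_Limsup tendsto_intros weakly_converges_bounded_linear[OF s(2) g]) simp
  finally show "x \<in> {x. h (fst x - v) \<le> g x + c}" by simp
qed

lemma truncated_mixed_problem:
  fixes A :: "'v::real_normed_vector \<Rightarrow> ('v \<Rightarrow>\<^sub>L real)"
    and J :: "'x::real_normed_vector \<Rightarrow> real"
    and h :: "'v \<Rightarrow> real"
    and \<gamma> :: "'v \<Rightarrow>\<^sub>L 'x"
    and b :: "'v \<Rightarrow> 'e::real_normed_vector \<Rightarrow> real"
    and f :: "'v \<Rightarrow>\<^sub>L real"
    and K :: "('v \<times> 'e) set"
  assumes refl: "reflexive_space TYPE('v)" "reflexive_space TYPE('e)"
    and K: "bounded K" "convex K" "closed K" "K \<noteq> {}"
    and A1: "\<And>w v. Limsup (at_right 0) (\<lambda>t::real. ereal (A (t *\<^sub>R w + (1 - t) *\<^sub>R v) (w - v)))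
               \<le> ereal (A v (w - v))"
    and A2: "\<And>u v \<xi> \<eta>. \<xi> \<in> clarke_gradient J (\<gamma> u) \<Longrightarrow> \<eta> \<in> clarke_gradient J (\<gamma> v) \<Longrightarrow>
               A u (u - v) + \<xi> (\<gamma> (u - v)) - A v (u - v) - \<eta> (\<gamma> (u - v)) \<ge> h (u - v)"
    and J: "locally_lipschitz J"
    and h1: "\<And>v. Limsup (at_right 0) (\<lambda>t::real. ereal (h (t *\<^sub>R v) / t)) \<ge> 0"
    and h2: "\<And>s v. weakly_converges_to s v \<Longrightarrow> ereal (h v) \<le> limsup (\<lambda>n. ereal (h (s n)))"
    and b: "bounded_bilinear b"
  shows "\<exists>u \<mu>. (u, \<mu>) \<in> K \<and> (\<forall>v \<rho>. (v, \<rho>) \<in> K \<longrightarrow>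
    0 \<le> A u (v - u) - f (v - u) + clarke J (\<gamma> u) (\<gamma> (v - u)) + b v \<mu> - b u \<rho>)"
proof -
  interpret b: bounded_bilinear b by (rule b)
  \<comment> \<open>The Minty form at the test point \<open>p\<close>. It is affine in the unknown
    \<open>x\<close>, and its coupling terms cancel when \<open>x = p\<close>.\<close>
  define \<Phi> where "\<Phi> p \<xi> x = A (fst p) (fst p - fst x) - f (fst p - fst x) + \<xi> (\<gamma> (fst p - fst x))
      + b (fst p) (snd x) - b (fst x) (snd p)" for p x and \<xi> :: "'x \<Rightarrow>\<^sub>L real"
  define G where "G p = (\<Inter>\<xi>\<in>clarke_gradient J (\<gamma> (fst p)). {x. h (fst x - fst p) \<le> \<Phi> p \<xi> x})" for p
  have G_closed: "weakly_seq_closed (G p)" for p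
  proof -
    have "weakly_seq_closed {x. h (fst x - fst p) \<le> \<Phi> p \<xi> x}" for \<xi>
    proof -
      define g where "g x = f (fst x) - A (fst p) (fst x) - \<xi> (\<gamma> (fst x)) + b (fst p) (snd x) - b (fst x) (snd p)"
        for x :: "'v \<times> 'e"
      define c where "c = A (fst p) (fst p) - f (fst p) + \<xi> (\<gamma> (fst p))"
      have "bounded_linear g"
        unfolding g_def
        by (intro bounded_linear_add bounded_linear_sub bounded_linear_fst bounded_linear_snd
            bounded_linear_compose[OF blinfun.bounded_linear_right]
            bounded_linear_compose[OF b.bounded_linear_right] bounded_linear_compose[OF b.bounded_linear_left])
      moreover have "\<Phi> p \<xi> = (\<lambda>x. g x + c)"
        by (simp add: fun_eq_iff \<Phi>_def g_def c_def blinfun.diff_right)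
      ultimately show ?thesis using weakly_seq_closed_Minty_set[OF h2, where g = g and c = c and v = "fst p"] by simp
    qed
    then show ?thesis unfolding G_def weakly_seq_closed_def by blast
  qed
  have "\<exists>x\<in>K. \<forall>p\<in>K. x \<in> G p"
  proof (rule weak_KKM[OF reflexive_space_prod[OF refl] K G_closed])
    fix P and c :: "'v \<times> 'e \<Rightarrow> real"
    assume P: "finite P" "P \<subseteq> K" and c: "\<And>p. p \<in> P \<Longrightarrow> 0 \<le> c p" "sum c P = 1"
    define x where "x = (\<Sum>q\<in>P. c q *\<^sub>R q)"
    define u where "u = fst x"
    define \<mu> where "\<mu> = snd x"
    have u: "u = (\<Sum>q\<in>P. c q *\<^sub>R fst q)" and \<mu>: "\<mu> = (\<Sum>q\<in>P. c q *\<^sub>R snd q)"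
      by (simp_all add: u_def \<mu>_def x_def fst_sum snd_sum)
    obtain \<xi> where \<xi>: "\<xi> \<in> clarke_gradient J (\<gamma> u)" using clarke_attained[OF J] by blast
    have "\<exists>p\<in>P. c p > 0 \<and> x \<in> G p"
    proof (rule ccontr)
      assume "\<not> (\<exists>p\<in>P. c p > 0 \<and> x \<in> G p)"
      then have out: "x \<notin> G p" if "p \<in> P" "c p > 0" for p using that by blast
      \<comment> \<open>This form is affine in \<open>p\<close> and vanishes at
        \<open>p = x\<close>, so its weighted sum over \<open>P\<close> is 0. If \<open>x\<close>
        avoided every \<open>G p\<close> of positive weight, A2 would make each such value negative.
        One \<open>\<xi>\<close> at \<open>u\<close>, fixed before \<open>p\<close>, serves all test
        points.\<close>
      define \<psi> where "\<psi> p = A u (fst p - u) - f (fst p - u) + \<xi> (\<gamma> (fst p - u)) + b (fst p) \<mu> - b u (snd p)" for p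
      have neg: "\<psi> p < 0" if "p \<in> P" "c p > 0" for p
      proof -
        have "x \<notin> G p" by (rule out[OF that])
        then obtain \<eta> where \<eta>: "\<eta> \<in> clarke_gradient J (\<gamma> (fst p))" "\<Phi> p \<eta> x < h (u - fst p)"
          by (auto simp: G_def u_def not_le)
        have "h (u - fst p) \<le> A u (u - fst p) + \<xi> (\<gamma> (u - fst p)) - A (fst p) (u - fst p) - \<eta> (\<gamma> (u - fst p))"
          by (rule A2[OF \<xi> \<eta>(1)])
        then show ?thesis
          using \<eta>(2) unfolding \<psi>_def \<Phi>_def u_def[symmetric] \<mu>_def[symmetric] by (simp add: blinfun.diff_right)
      qed
      have lin_u: "(\<Sum>q\<in>P. c q * \<phi> (fst q)) = \<phi> u" if "linear \<phi>" for \<phi> :: "'v \<Rightarrow> real"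
        unfolding u by (simp add: linear_sum[OF that] linear_cmul[OF that])
      have lin_\<mu>: "(\<Sum>q\<in>P. c q * \<phi> (snd q)) = \<phi> \<mu>" if "linear \<phi>" for \<phi> :: "'e \<Rightarrow> real"
        unfolding \<mu> by (simp add: linear_sum[OF that] linear_cmul[OF that])
      have su: "(\<Sum>q\<in>P. c q * A u (fst q)) = A u u" "(\<Sum>q\<in>P. c q * f (fst q)) = f u"
        "(\<Sum>q\<in>P. c q * \<xi> (\<gamma> (fst q))) = \<xi> (\<gamma> u)"
        using lin_u[OF bounded_linear.linear[OF blinfun.bounded_linear_right[of "A u"]]]
          lin_u[OF bounded_linear.linear[OF blinfun.bounded_linear_right[of f]]]
          lin_u[OF bounded_linear.linear[OF bounded_linear_compose[OF
                blinfun.bounded_linear_right[of \<xi>] blinfun.bounded_linear_right[of \<gamma>]]]]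
        by this+
      have sb: "(\<Sum>q\<in>P. c q * b (fst q) \<mu>) = b u \<mu>" "(\<Sum>q\<in>P. c q * b u (snd q)) = b u \<mu>"
        using lin_u[OF bounded_linear.linear[OF b.bounded_linear_left[of \<mu>]]]
          lin_\<mu>[OF bounded_linear.linear[OF b.bounded_linear_right[of u]]] by this+
      have const: "(\<Sum>p\<in>P. c p * k) = k" for k
        using c(2) by (simp add: sum_distrib_right[symmetric])
      have "(\<Sum>p\<in>P. c p * \<psi> p) = 0"
        by (simp add: \<psi>_def blinfun.diff_right right_diff_distrib distrib_left sum_subtractf sum.distrib const su sb)
      moreover have "(\<Sum>p\<in>P. c p * \<psi> p) < 0"
      proof -
        have "\<exists>p\<in>P. c p > 0"
        proof (rule ccontr)
          assume "\<not> (\<exists>p\<in>P. c p > 0)"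
          then have "sum c P = 0" using c(1) by (intro sum.neutral) force
          with c(2) show False by simp
        qed
        then obtain p where p: "p \<in> P" "c p > 0" by blast
        have "0 < (\<Sum>p\<in>P. - (c p * \<psi> p))"
        proof (rule sum_pos2[OF P(1) p(1)])
          show "0 < - (c p * \<psi> p)" using p neg[OF p] by (simp add: mult_pos_neg)
          show "0 \<le> - (c q * \<psi> q)" if "q \<in> P" for q
            using c(1)[OF that] neg[OF that] by (cases "c q = 0") (auto simp: mult_nonneg_nonpos less_le)
        qed
        then show ?thesis by (simp add: sum_negf)
      qed
      ultimately show False by simp
    qed
    then show "\<exists>p\<in>P. c p > 0 \<and> (\<Sum>q\<in>P. c q *\<^sub>R q) \<in> G p" by (simp add: x_def)
  qed
  then obtain u \<mu> where x: "(u, \<mu>) \<in> K" "\<And>p. p \<in> K \<Longrightarrow> (u, \<mu>) \<in> G p" by fastforce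
  have "0 \<le> A u (w - u) - f (w - u) + clarke J (\<gamma> u) (\<gamma> (w - u)) + b w \<mu> - b u \<rho>"
    if w: "(w, \<rho>) \<in> K" for w \<rho>
  proof (rule field_le_epsilon)
    fix e :: real assume e: "e > 0"
    \<comment> \<open>The Minty inequality is tested at points of the segment from \<open>u\<close>
      to \<open>w\<close>, divided by \<open>t\<close>, and compared with the values at
      \<open>u\<close> for small \<open>t\<close>.\<close>
    define v where "v t = t *\<^sub>R w + (1 - t) *\<^sub>R u" for t :: real
    have v_diff: "v t - u = t *\<^sub>R (w - u)" for t by (simp add: v_def algebra_simps)
    have "(v \<longlongrightarrow> 0 *\<^sub>R w + (1 - 0) *\<^sub>R u) (at_right 0)" unfolding v_def by (intro tendsto_intros)
    then have "(v \<longlongrightarrow> u) (at_right 0)" by simp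
    then have lim: "((\<lambda>t. \<gamma> (v t)) \<longlongrightarrow> \<gamma> u) (at_right 0)" by (rule blinfun.tendsto[OF tendsto_const])
    have "eventually (\<lambda>y. clarke J y (\<gamma> (w - u)) \<le> clarke J (\<gamma> u) (\<gamma> (w - u)) + e / 3) (nhds (\<gamma> u))"
      using e by (intro clarke_upper_semicontinuous[OF J]) simp
    then have evJ: "eventually (\<lambda>t. clarke J (\<gamma> (v t)) (\<gamma> (w - u)) \<le> clarke J (\<gamma> u) (\<gamma> (w - u)) + e / 3) (at_right 0)"
      using lim by (rule eventually_compose_filterlim)
    have "Limsup (at_right 0) (\<lambda>t. ereal (A (v t) (w - u))) < ereal (A u (w - u) + e / 3)"
      unfolding v_def by (rule le_less_trans[OF A1]) (use e in simp)
    from Limsup_lessD[OF this]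
    have evA: "eventually (\<lambda>t. A (v t) (w - u) < A u (w - u) + e / 3) (at_right 0)" by simp
    \<comment> \<open>The upper limit in h1 yields suitable \<open>t\<close> only arbitrarily close
      to 0. The other two estimates hold for all small positive \<open>t\<close>, so a common
      \<open>t\<close> exists.\<close>
    have freq: "frequently (\<lambda>t. h (t *\<^sub>R (u - w)) / t > - e / 3) (at_right 0)"
    proof (rule ccontr)
      assume "\<not> ?thesis"
      then have "eventually (\<lambda>t. ereal (h (t *\<^sub>R (u - w)) / t) \<le> ereal (- e / 3)) (at_right 0)"
        by (simp add: frequently_def not_less)
      then have "Limsup (at_right 0) (\<lambda>t. ereal (h (t *\<^sub>R (u - w)) / t)) \<le> ereal (- e / 3)"
        by (rule Limsup_bounded)
      with h1[of "u - w"] have "0 \<le> ereal (- e / 3)" by (rule order_trans)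
      with e show False by simp
    qed
    have ev1: "eventually (\<lambda>t. 0 < t \<and> t < (1::real)) (at_right 0)"
      by (auto simp: eventually_at_right_field intro!: exI[of _ 1])
    obtain t where t: "h (t *\<^sub>R (u - w)) / t > - e / 3"
      "clarke J (\<gamma> (v t)) (\<gamma> (w - u)) \<le> clarke J (\<gamma> u) (\<gamma> (w - u)) + e / 3"
      "A (v t) (w - u) < A u (w - u) + e / 3" "0 < t" "t < 1"
      using frequently_ex[OF frequently_eventually_frequently[OF freq
            eventually_conj[OF evJ eventually_conj[OF evA ev1]]]] by blast
    define \<sigma> where "\<sigma> = t *\<^sub>R \<rho> + (1 - t) *\<^sub>R \<mu>"
    have "(v t, \<sigma>) \<in> K"
      using convexD[OF K(2) w x(1), of t "1 - t"] t by (simp add: v_def \<sigma>_def)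
    then have mem: "(u, \<mu>) \<in> G (v t, \<sigma>)" by (rule x(2))
    obtain \<xi> where \<xi>: "\<xi> \<in> clarke_gradient J (\<gamma> (v t))" using clarke_attained[OF J] by blast
    have Minty: "h (u - v t) \<le> A (v t) (v t - u) - f (v t - u) + \<xi> (\<gamma> (v t - u)) + b (v t) \<mu> - b u \<sigma>"
      using mem \<xi> by (simp add: G_def \<Phi>_def)
    \<comment> \<open>Both values contain \<open>(1 - t) * b u \<mu>\<close>, so their difference is
      proportional to \<open>t\<close>, like the remaining terms on the right.\<close>
    have "b (v t) \<mu> = t * b w \<mu> + (1 - t) * b u \<mu>" "b u \<sigma> = t * b u \<rho> + (1 - t) * b u \<mu>"
      by (simp_all only: v_def \<sigma>_def b.add_left b.add_right b.scaleR_left b.scaleR_right real_scaleR_def)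
    moreover have uv: "u - v t = t *\<^sub>R (u - w)" using v_diff[of t] by (simp add: algebra_simps)
    ultimately have "h (t *\<^sub>R (u - w)) \<le> t * A (v t) (w - u) - t * f (w - u) + t * \<xi> (\<gamma> (w - u)) + t * b w \<mu> - t * b u \<rho>"
      using Minty unfolding uv v_diff blinfun.scaleR_right real_scaleR_def by linarith
    also have "\<dots> = (A (v t) (w - u) - f (w - u) + \<xi> (\<gamma> (w - u)) + b w \<mu> - b u \<rho>) * t"
      by (simp add: algebra_simps)
    finally have "h (t *\<^sub>R (u - w)) / t \<le> A (v t) (w - u) - f (w - u) + \<xi> (\<gamma> (w - u)) + b w \<mu> - b u \<rho>"
      using t(4) by (simp add: pos_divide_le_eq)
    moreover have "\<xi> (\<gamma> (w - u)) \<le> clarke J (\<gamma> (v t)) (\<gamma> (w - u))"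
      using \<xi> by (simp add: clarke_gradient_iff[OF J])
    ultimately show "0 \<le> A u (w - u) - f (w - u) + clarke J (\<gamma> u) (\<gamma> (w - u)) + b w \<mu> - b u \<rho> + e"
      using t(1-3) by simp
  qed
  with x(1) show ?thesis by blast
qed

subsection \<open>A priori bounds\<close>

text \<open>For \<open>norm u \<ge> 1\<close> the constant, the linear term and the power
  \<open>\<theta>\<close> are all dominated by the power \<open>max \<theta> 1\<close>, which
  \<open>A u u\<close> outgrows.\<close>

lemma coercive_bound:
  fixes A :: "'v::real_normed_vector \<Rightarrow> ('v \<Rightarrow>\<^sub>L real)" and f :: "'v \<Rightarrow>\<^sub>L real"
    and \<gamma> :: "'v \<Rightarrow>\<^sub>L 'x::real_normed_vector"
  assumes A3: "filterlim (\<lambda>v. A v v / norm v powr (max \<theta> 1)) at_top at_infinity"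
    and c: "\<theta> \<ge> 0" "\<alpha> \<ge> 0" "\<beta> \<ge> 0"
  obtains C where "C > 0" "\<And>u. A u u \<le> f u + \<alpha> + \<beta> * norm (\<gamma> u) powr \<theta> \<Longrightarrow> norm u \<le> C"
proof -
  define m where "m = max \<theta> 1"
  \<comment> \<open>One more than the sum of the coefficients that bound the right-hand side, so
    that growth at rate \<open>M\<close> is contradictory.\<close>
  define M where "M = norm f + \<alpha> + \<beta> * norm \<gamma> powr \<theta> + 1"
  obtain C where C: "\<And>v. C \<le> norm v \<Longrightarrow> M \<le> A v v / norm v powr m"
    using A3 unfolding filterlim_at_top eventually_at_infinity m_def by blast
  have "norm u \<le> max C 1" if u: "A u u \<le> f u + \<alpha> + \<beta> * norm (\<gamma> u) powr \<theta>" for u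
  proof (rule ccontr)
    define r where "r = norm u"
    assume "\<not> norm u \<le> max C 1"
    then have r: "C \<le> norm u" "1 \<le> r" by (auto simp: r_def)
    have rm: "r \<le> r powr m" "r powr \<theta> \<le> r powr m" "1 \<le> r powr m"
      using r(2) powr_mono[of 1 m r] c(1) by (auto simp: m_def intro: powr_mono ge_one_powr_ge_zero)
    have "f u \<le> norm f * r" using norm_blinfun[of f u] by (simp add: r_def)
    also have "\<dots> \<le> norm f * r powr m" using rm by (intro mult_left_mono) auto
    finally have 1: "f u \<le> norm f * r powr m" .
    have 2: "\<alpha> \<le> \<alpha> * r powr m" using c rm(3) by (simp add: mult_le_cancel_left1)
    have "norm (\<gamma> u) powr \<theta> \<le> (norm \<gamma> * r) powr \<theta>"
      using norm_blinfun[of \<gamma> u] c by (intro powr_mono2) (auto simp: r_def)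
    also have "\<dots> = norm \<gamma> powr \<theta> * r powr \<theta>" by (rule powr_mult)
    also have "\<dots> \<le> norm \<gamma> powr \<theta> * r powr m" using rm by (intro mult_left_mono) auto
    finally have 3: "\<beta> * norm (\<gamma> u) powr \<theta> \<le> \<beta> * (norm \<gamma> powr \<theta> * r powr m)"
      using c by (intro mult_left_mono)
    have "0 < r powr m" using rm(3) by linarith
    then have "M * r powr m \<le> A u u"
      using C[OF r(1)] pos_le_divide_eq[of "r powr m" M] unfolding r_def by blast
    also have "\<dots> \<le> (M - 1) * r powr m"
      using u 1 2 3 by (simp add: M_def algebra_simps)
    finally show False using rm(3) by (simp add: algebra_simps)
  qed
  then show ?thesis using that[of "max C 1"] by (simp add: less_max_iff_disj)
qed

text \<open>Reading the infimum at \<open>\<mu>\<close> bounds the multiplier by the size of the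
  functional it induces through \<open>b\<close>.\<close>

lemma inf_sup_bound:
  fixes b :: "'v::real_normed_vector \<Rightarrow> 'e::real_normed_vector \<Rightarrow> real"
  assumes infsup: "(INF \<rho>\<in>UNIV - {0}. SUP v\<in>UNIV - {0}. ereal (b v \<rho> / (norm v * norm \<rho>))) \<ge> ereal \<alpha>"
    and "\<alpha> > 0" "C \<ge> 0" and le: "\<And>v. b v \<mu> \<le> C * norm v"
  shows "norm \<mu> \<le> C / \<alpha>"
proof (cases "\<mu> = 0")
  case False
  have "ereal \<alpha> \<le> (SUP v\<in>UNIV - {0}. ereal (b v \<mu> / (norm v * norm \<mu>)))"
    using infsup False by (auto intro: order_trans INF_lower)
  also have "\<dots> \<le> ereal (C / norm \<mu>)"
  proof (rule SUP_least)
    fix v :: 'v assume "v \<in> UNIV - {0}"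
    then show "ereal (b v \<mu> / (norm v * norm \<mu>)) \<le> ereal (C / norm \<mu>)"
      using le[of v] False by (simp add: field_simps)
  qed
  finally show ?thesis using False \<open>\<alpha> > 0\<close> by (simp add: field_simps)
qed (use assms in simp)

section \<open>Choice of the truncation radii and removal of the truncation\<close>

theorem theorem10:
  fixes A :: "'v::banach \<Rightarrow> ('v \<Rightarrow>\<^sub>L real)"
    and J :: "'x::banach \<Rightarrow> real"
    and h :: "'v \<Rightarrow> real"
    and \<gamma> :: "'v \<Rightarrow>\<^sub>L 'x"
    and b :: "'v \<Rightarrow> 'e::banach \<Rightarrow> real"
    and f :: "'v \<Rightarrow>\<^sub>L real"
    and \<Lambda> :: "'e set"
    and \<theta> \<alpha>\<^sub>J \<beta>\<^sub>J \<alpha>\<^sub>b :: real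
  assumes V_reflexive: "reflexive_space TYPE('v)"
    and E_reflexive: "reflexive_space TYPE('e)"
    and Lam: "\<Lambda> \<noteq> {}" "closed \<Lambda>" "convex \<Lambda>" "0 \<in> \<Lambda>"
    and A1: "\<And>w v. Limsup (at_right 0) (\<lambda>t::real. ereal (blinfun_apply (A (t *\<^sub>R w + (1 - t) *\<^sub>R v)) (w - v)))
               \<le> ereal (blinfun_apply (A v) (w - v))"
    and A2: "\<And>u v \<xi>u \<xi>v. \<lbrakk>\<xi>u \<in> clarke_gradient J (blinfun_apply \<gamma> u); \<xi>v \<in> clarke_gradient J (blinfun_apply \<gamma> v)\<rbrakk> \<Longrightarrow>
               blinfun_apply (A u + dual_adjoint \<gamma> \<xi>u - A v - dual_adjoint \<gamma> \<xi>v) (u - v) \<ge> h (u - v)"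
    and A3: "filterlim (\<lambda>v. blinfun_apply (A v) v / norm v powr (max \<theta> 1)) at_top at_infinity"
    and A4: "\<And>S. bounded S \<Longrightarrow> bounded (A ` S)"
    and J1: "locally_lipschitz J"
    and J2_const: "\<theta> \<ge> 0" "\<alpha>\<^sub>J \<ge> 0" "\<beta>\<^sub>J > 0"
    and J2: "\<And>x. clarke_deriv J x (- x) \<le> ereal (\<alpha>\<^sub>J + \<beta>\<^sub>J * norm x powr \<theta>)"
    and J3: "\<And>S. bounded S \<Longrightarrow> bounded (\<Union>x\<in>S. clarke_gradient J x)"
    and h0: "h 0 = 0"
    and h1: "\<And>v. Limsup (at_right 0) (\<lambda>t::real. ereal (h (t *\<^sub>R v) / t)) \<ge> 0"
    and h2: "\<And>s v. weakly_converges_to s v \<Longrightarrow> ereal (h v) \<le> limsup (\<lambda>n. ereal (h (s n)))"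
    and b_bilinear: "bounded_bilinear b"
    and b_const: "\<alpha>\<^sub>b > 0"
    and b_infsup: "(INF \<rho>\<in>UNIV - {0}. SUP v\<in>UNIV - {0}. ereal (b v \<rho> / (norm v * norm \<rho>)))
                     \<ge> ereal \<alpha>\<^sub>b"
  shows "\<exists>u::'v. \<exists>lam\<in>\<Lambda>.
           (\<forall>v. ereal (blinfun_apply (A u) (v - u) + b (v - u) lam) + clarke_deriv J (blinfun_apply \<gamma> u) (blinfun_apply \<gamma> v - blinfun_apply \<gamma> u)
                  \<ge> ereal (blinfun_apply f (v - u))) \<and>
           (\<forall>\<rho>\<in>\<Lambda>. b u (\<rho> - lam) \<le> 0)"
proof -
  interpret b: bounded_bilinear b by (rule b_bilinear)
  have A2': "A u (u - v) + \<xi> (\<gamma> (u - v)) - A v (u - v) - \<eta> (\<gamma> (u - v)) \<ge> h (u - v)"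
    if "\<xi> \<in> clarke_gradient J (\<gamma> u)" "\<eta> \<in> clarke_gradient J (\<gamma> v)" for u v \<xi> \<eta>
    using A2[OF that] by (simp add: dual_adjoint_def blinfun.diff_left blinfun.add_left)
  \<comment> \<open>This bound refers only to the inequality obtained by testing with the origin, so
    it is available before any radius is chosen.\<close>
  obtain C0 where C0: "C0 > 0"
    "\<And>u. A u u \<le> f u + \<alpha>\<^sub>J + \<beta>\<^sub>J * norm (\<gamma> u) powr \<theta> \<Longrightarrow> norm u \<le> C0"
    using coercive_bound[OF A3 J2_const(1,2) less_imp_le[OF J2_const(3)]] by blast
  obtain a where "\<forall>u\<in>cball 0 C0. norm (A u) \<le> a"
    using A4[OF bounded_cball[of 0 C0]] unfolding bounded_iff by blast
  then have a: "norm (A u) \<le> a" if "norm u \<le> C0" for u using that by simp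
  have "bounded (\<gamma> ` cball 0 C0)"
    by (intro bounded_linear_image blinfun.bounded_linear_right bounded_cball)
  from J3[OF this] obtain g where "\<forall>u\<in>cball 0 C0. \<forall>\<xi>\<in>clarke_gradient J (\<gamma> u). norm \<xi> \<le> g"
    unfolding bounded_iff by auto
  then have g: "norm \<xi> \<le> g" if "norm u \<le> C0" "\<xi> \<in> clarke_gradient J (\<gamma> u)" for u \<xi>
    using that by simp
  \<comment> \<open>This will bound \<open>b w \<mu>\<close> relative to \<open>norm w\<close>,
    through the bounds on \<open>A\<close> and on the gradients over the ball of radius
    \<open>C0\<close>. It does not involve \<open>R\<close>; taking the maximum with 0 supplies the
    sign needed in \<open>inf_sup_bound\<close>.\<close>
  define C1 where "C1 = max 0 (a + norm f + g * norm \<gamma>)"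
  define R where "R = C1 / \<alpha>\<^sub>b + 1"
  \<comment> \<open>Both radii exceed the a priori bounds by 1, which leaves room for short steps
    away from the solution.\<close>
  define K where "K = cball (0::'v) (C0 + 1) \<times> (\<Lambda> \<inter> cball 0 R)"
  have "R > 0" using b_const by (simp add: R_def C1_def add_nonneg_pos)
  have "bounded K" unfolding K_def by (intro bounded_Times bounded_cball bounded_Int) simp
  moreover have "convex K" unfolding K_def by (intro convex_Times convex_cball convex_Int Lam)
  moreover have "closed K" unfolding K_def by (intro closed_Times closed_cball closed_Int Lam)
  moreover have K0: "(0, 0) \<in> K" using C0(1) \<open>R > 0\<close> Lam(4) by (simp add: K_def)
  then have "K \<noteq> {}" by blast
  ultimately have "\<exists>u \<mu>. (u, \<mu>) \<in> K \<and> (\<forall>v \<rho>. (v, \<rho>) \<in> K \<longrightarrow>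
    0 \<le> A u (v - u) - f (v - u) + clarke J (\<gamma> u) (\<gamma> (v - u)) + b v \<mu> - b u \<rho>)"
    by (rule truncated_mixed_problem[OF V_reflexive E_reflexive _ _ _ _ A1 A2' J1 h1 h2 b_bilinear])
  then obtain u \<mu> where u\<mu>: "(u, \<mu>) \<in> K"
    and sol: "\<And>v \<rho>. (v, \<rho>) \<in> K \<Longrightarrow> 0 \<le> A u (v - u) - f (v - u) + clarke J (\<gamma> u) (\<gamma> (v - u)) + b v \<mu> - b u \<rho>"
    by blast
  have \<mu>: "\<mu> \<in> \<Lambda>" "norm \<mu> \<le> R" using u\<mu> by (auto simp: K_def)

  \<comment> \<open>At the test point \<open>(0, 0)\<close> both coupling terms vanish, and J2 turns
    the inequality into the premise of the coercive bound.\<close>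
  have "clarke J (\<gamma> u) (- \<gamma> u) \<le> \<alpha>\<^sub>J + \<beta>\<^sub>J * norm (\<gamma> u) powr \<theta>"
    using J2[of "\<gamma> u"] by (simp add: clarke_deriv_eq_clarke[OF J1])
  then have u: "norm u \<le> C0"
    using sol[OF K0] by (intro C0(2)) (simp add: blinfun.minus_right b.zero_left b.zero_right)

  \<comment> \<open>Keeping \<open>\<mu>\<close> and moving \<open>u\<close> by \<open>t w\<close>
    stays inside the larger ball. The coupling becomes \<open>t * b w \<mu>\<close>, and positive
    homogeneity of the Clarke derivative lets \<open>t\<close> be divided out.\<close>
  have first: "0 \<le> A u w - f w + clarke J (\<gamma> u) (\<gamma> w) + b w \<mu>" for w
  proof -
    define t where "t = 1 / (norm w + 1)"
    have t: "t > 0" "t * norm w \<le> 1" by (simp_all add: t_def add_nonneg_pos divide_le_eq)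
    have "norm (u + t *\<^sub>R w) \<le> C0 + 1" using norm_triangle_ineq[of u "t *\<^sub>R w"] u t by simp
    then have "(u + t *\<^sub>R w, \<mu>) \<in> K" using \<mu> by (simp add: K_def)
    from sol[OF this] have "0 \<le> t * (A u w - f w + clarke J (\<gamma> u) (\<gamma> w) + b w \<mu>)"
      using t(1) by (simp add: blinfun.scaleR_right sublinear_scale[OF sublinear_clarke[OF J1]]
          b.add_left b.scaleR_left algebra_simps)
    then show ?thesis using t(1) by (simp add: zero_le_mult_iff)
  qed

  have "b w \<mu> \<le> C1 * norm w" for w
  proof -
    \<comment> \<open>A gradient attaining the derivative in the direction \<open>- w\<close>
      replaces the nonsmooth term by a pairing controlled by J3.\<close>
    obtain \<xi> where \<xi>: "\<xi> \<in> clarke_gradient J (\<gamma> u)" "\<xi> (\<gamma> (- w)) = clarke J (\<gamma> u) (\<gamma> (- w))"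
      using clarke_attained[OF J1] by blast
    have "\<xi> (\<gamma> (- w)) \<le> norm \<xi> * norm (\<gamma> (- w))"
      using norm_blinfun[of \<xi> "\<gamma> (- w)"] by simp
    also have "\<dots> \<le> g * (norm \<gamma> * norm w)"
      using norm_blinfun[of \<gamma> "- w"] g[OF u \<xi>(1)] order_trans[OF norm_ge_zero g[OF u \<xi>(1)]]
      by (intro mult_mono) auto
    finally have "\<xi> (\<gamma> (- w)) \<le> g * (norm \<gamma> * norm w)" .
    moreover have "A u (- w) \<le> a * norm w"
      using norm_blinfun[of "A u" "- w"] mult_right_mono[OF a[OF u] norm_ge_zero[of w]] by simp
    moreover have "- f (- w) \<le> norm f * norm w"
      using norm_blinfun[of f w] by (simp add: blinfun.minus_right)
    moreover have "b w \<mu> \<le> A u (- w) - f (- w) + \<xi> (\<gamma> (- w))"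
      using first[of "- w"] \<xi>(2) by (simp add: b.minus_left)
    ultimately have "b w \<mu> \<le> (a + norm f + g * norm \<gamma>) * norm w"
      by (simp add: algebra_simps)
    also have "\<dots> \<le> C1 * norm w" by (intro mult_right_mono) (auto simp: C1_def)
    finally show ?thesis .
  qed
  then have \<mu>_less: "norm \<mu> \<le> C1 / \<alpha>\<^sub>b"
    by (intro inf_sup_bound[OF b_infsup b_const]) (simp_all add: C1_def)

  \<comment> \<open>With \<open>v = u\<close> only the coupling remains. A short step from
    \<open>\<mu>\<close> towards \<open>\<rho>\<close> stays in \<open>\<Lambda>\<close> by
    convexity and within radius \<open>R\<close> by the multiplier bound.\<close>
  have second: "b u (\<rho> - \<mu>) \<le> 0" if "\<rho> \<in> \<Lambda>" for \<rho>
  proof -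
    define t where "t = 1 / (norm (\<rho> - \<mu>) + 1)"
    have t: "t > 0" "t \<le> 1" "t * norm (\<rho> - \<mu>) \<le> 1" by (simp_all add: t_def add_nonneg_pos divide_le_eq)
    have eq: "(1 - t) *\<^sub>R \<mu> + t *\<^sub>R \<rho> = \<mu> + t *\<^sub>R (\<rho> - \<mu>)" by (simp add: algebra_simps)
    have "\<mu> + t *\<^sub>R (\<rho> - \<mu>) \<in> \<Lambda>"
      using convexD[OF Lam(3) \<mu>(1) that, of "1 - t" t] t unfolding eq by simp
    moreover have "norm (\<mu> + t *\<^sub>R (\<rho> - \<mu>)) \<le> R"
      using norm_triangle_ineq[of \<mu> "t *\<^sub>R (\<rho> - \<mu>)"] \<mu>_less t by (simp add: R_def)
    ultimately have "(u, \<mu> + t *\<^sub>R (\<rho> - \<mu>)) \<in> K" using u by (simp add: K_def)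
    from sol[OF this] have "t * b u (\<rho> - \<mu>) \<le> 0"
      by (simp add: sublinear_0[OF sublinear_clarke[OF J1]] b.add_right b.scaleR_right)
    then show ?thesis using t(1) by (simp add: mult_le_0_iff)
  qed

  show ?thesis
  proof (intro exI bexI conjI allI ballI)
    fix v
    show "ereal (f (v - u)) \<le> ereal (A u (v - u) + b (v - u) \<mu>) + clarke_deriv J (\<gamma> u) (\<gamma> v - \<gamma> u)"
      using first[of "v - u"] by (simp add: clarke_deriv_eq_clarke[OF J1] blinfun.diff_right)
  qed (use second \<mu>(1) in auto)
qed

end
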